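(* Let $\mathcal{L}_{\mathrm{ax}}=\{e^{i\theta Z}:\theta\in\mathbb{R}\}$ be the group of single-qubit axial rotations, where $Z=\mathrm{diag}(1,-1)$. Let $\mathcal{G}$ be a set of single-qubit unitary gates ($2\times 2$ unitary matrices) with cost function $\mathfrak{C}:\mathcal{G}\to\mathbb{R}^+$ such that $Z\in\mathcal{G}$ and $\mathfrak{C}(Z)=0$. Let $f_{\mathrm{ax}}$ be a real-valued function on $(0,\infty)$ and assume that for every $V\in\mathcal{L}_{\mathrm{ax}}$ and every $\epsilon>0$ there is a finite sequence $W_1,\ldots,W_N\in\mathcal{G}$ whose product $U=W_1W_2\cdots W_N\in\langle\mathcal{G}\rangle$ satisfies $$\|U-V\|\le\epsilon\qquad\text{and}\qquad \sum_{j=1}^N\mathfrak{C}(W_j)\le f_{\mathrm{ax}}(\epsilon).$$ Then for every $V\in\mathcal{L}_{\mathrm{ax}}$ and every $\epsilon$ with $0<\epsilon<0.01$ there exist unitaries $U_1,U_2,U_3,U_4\in\langle\mathcal{G}\rangle$, each of cost at most $f_{\mathrm{ax}}(\epsilon)$, and probabilities $p_1,\ldots,p_4\ge0$ with $\sum_{j=1}^4p_j=1$, such that the channel $$\mathcal{E}(\rho)=\sum_{j=1}^{4}p_jU_j\rho U_j^\dagger$$ satisfies $$d_\diamond(\mathcal{E},\mathcal{V})\le 5\,\epsilon^2,$$ where $\mathcal{V}(\rho)=V\rho V^\dagger$.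
   Context: $\|X\|$ denotes the operator norm (largest singular value) and $\|X\|_1$ the Schatten 1-norm (sum of singular values). For a linear map $\mathcal{E}$ on operators on a finite-dimensional Hilbert space, the diamond norm is $\|\mathcal{E}\|_\diamond:=\sup\{\|(\mathcal{E}\otimes\mathrm{id})(X)\|_1:\|X\|_1\le 1\}$, where $\mathrm{id}$ is the identity map on operators on an auxiliary finite-dimensional Hilbert space (of arbitrary dimension; the dimension of the original space suffices). The diamond distance is $d_\diamond(\mathcal{E},\mathcal{E}'):=\frac12\|\mathcal{E}-\mathcal{E}'\|_\diamond$. $\langle\mathcal{G}\rangle$ is the group generated by $\mathcal{G}$ (it need not be contained in $\mathcal{L}_{\mathrm{ax}}$). The cost function $\mathfrak{C}$ takes nonnegative real values. The cost of a sequence $W_1,\ldots,W_N$ of elements of $\mathcal{G}$ is $\sum_{j=1}^N\mathfrak{C}(W_j)$; a unitary $U$ has cost at most $t$ if it can be written as $U=W_1\cdots W_N$ with $W_j\in\mathcal{G}$ and $\sum_j\mathfrak{C}(W_j)\le t$. The assumption on $f_{\mathrm{ax}}$ expresses that there is a unitary synthesis algorithm for axial rotations with worst-case cost $f_{\mathrm{ax}}$. *)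

theory Defs
  imports
    Complex_Main
    "HOL-Algebra.Generated_Groups"
    "Jordan_Normal_Form.Schur_Decomposition"
begin

definition unitary_mat :: "nat \<Rightarrow> complex mat \<Rightarrow> bool" where
  "unitary_mat n U \<longleftrightarrow>
     U \<in> carrier_mat n n \<and> mat_adjoint U * U = 1\<^sub>m n \<and> U * mat_adjoint U = 1\<^sub>m n"

definition unitary_group :: "nat \<Rightarrow> complex mat monoid" where
  "unitary_group n = \<lparr>carrier = {U. unitary_mat n U}, monoid.mult = (*), one = 1\<^sub>m n\<rparr>"

(* Square roots of the eigenvalues of X^* X, with algebraic multiplicity. These eigenvalues
   are nonnegative reals, so taking real parts loses nothing. *)
definition singular_values :: "complex mat \<Rightarrow> real multiset" where
  "singular_values X = image_mset (\<lambda>z. sqrt (Re z)) (proots (char_poly (mat_adjoint X * X)))"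

definition op_norm :: "complex mat \<Rightarrow> real" where
  "op_norm X = Max (set_mset (singular_values X))"

definition trace_norm :: "complex mat \<Rightarrow> real" where
  "trace_norm X = sum_mset (singular_values X)"

definition tensor_mat :: "complex mat \<Rightarrow> complex mat \<Rightarrow> complex mat" where
  "tensor_mat A B =
     mat (dim_row A * dim_row B) (dim_col A * dim_col B)
       (\<lambda>(i, j). A $$ (i div dim_row B, j div dim_col B) * B $$ (i mod dim_row B, j mod dim_col B))"

(* E \<otimes> id for a linear map E on d x d matrices and an auxiliary space of dimension n.
   Writing X as the sum over k, l < n of tensor_mat X_kl (k,l-th matrix unit), with X_kl a
   d x d matrix, E is applied to each X_kl. See tensor_id_tensor_mat below. *)
definition tensor_id ::
  "nat \<Rightarrow> nat \<Rightarrow> (complex mat \<Rightarrow> complex mat) \<Rightarrow> complex mat \<Rightarrow> complex mat" where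
  "tensor_id d n E X =
     mat (d * n) (d * n)
       (\<lambda>(i, j). E (mat d d (\<lambda>(a, b). X $$ (a * n + i mod n, b * n + j mod n)))
                   $$ (i div n, j div n))"

(* For linear E the set is bounded above (uniformly in n), so this real supremum is genuine. *)
definition diamond_norm :: "nat \<Rightarrow> (complex mat \<Rightarrow> complex mat) \<Rightarrow> real" where
  "diamond_norm d E =
     Sup {trace_norm (tensor_id d n E X) | n X.
            n > 0 \<and> X \<in> carrier_mat (d * n) (d * n) \<and> trace_norm X \<le> 1}"

definition diamond_dist ::
  "nat \<Rightarrow> (complex mat \<Rightarrow> complex mat) \<Rightarrow> (complex mat \<Rightarrow> complex mat) \<Rightarrow> real" where
  "diamond_dist d E E' = 1 / 2 * diamond_norm d (\<lambda>X. E X - E' X)"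

definition unitary_channel :: "complex mat \<Rightarrow> complex mat \<Rightarrow> complex mat" where
  "unitary_channel U \<rho> = U * \<rho> * mat_adjoint U"

(* The sum over k in J of p k * U k * \<rho> * (U k)^*, written entrywise because the type of
   matrices of all dimensions has no zero and hence no big sum operator. *)
definition mixed_unitary_channel ::
  "nat \<Rightarrow> 'k set \<Rightarrow> ('k \<Rightarrow> real) \<Rightarrow> ('k \<Rightarrow> complex mat) \<Rightarrow> complex mat \<Rightarrow> complex mat" where
  "mixed_unitary_channel d J p U \<rho> =
     mat d d (\<lambda>(i, j). \<Sum>k\<in>J. complex_of_real (p k) * unitary_channel (U k) \<rho> $$ (i, j))"

definition mat_exp :: "complex mat \<Rightarrow> complex mat" where
  "mat_exp A =
     mat (dim_row A) (dim_row A) (\<lambda>(i, j). \<Sum>k. (A ^\<^sub>m k) $$ (i, j) / fact k)"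

definition pauli_Z :: "complex mat" where
  "pauli_Z = mat_of_rows_list 2 [[1, 0], [0, -1]]"

definition axial_rotations :: "complex mat set" where
  "axial_rotations = {mat_exp ((\<i> * complex_of_real \<theta>) \<cdot>\<^sub>m pauli_Z) | \<theta>. True}"

(* The empty product (the identity, at cost 0) is allowed. *)
definition cost_at_most ::
  "nat \<Rightarrow> complex mat set \<Rightarrow> (complex mat \<Rightarrow> real) \<Rightarrow> real \<Rightarrow> complex mat \<Rightarrow> bool" where
  "cost_at_most n G C t U \<longleftrightarrow>
     (\<exists>Ws. set Ws \<subseteq> G \<and> U = foldr (*) Ws (1\<^sub>m n) \<and> sum_list (map C Ws) \<le> t)"

lemma group_unitary_group: "group (unitary_group n)"
proof (rule groupI)
  have adj: "mat_adjoint U \<in> carrier_mat n n" if "U \<in> carrier_mat n n" for U :: "complex mat"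
    using that unfolding mat_adjoint_def carrier_mat_def by auto
  have adj_idx: "mat_adjoint U $$ (i, j) = cnj (U $$ (j, i))"
    if "U \<in> carrier_mat n n" "i < n" "j < n" for U i j
    using that unfolding mat_adjoint_def by (auto simp: mat_of_rows_index)
  have adj_adj: "mat_adjoint (mat_adjoint U) = U" if "U \<in> carrier_mat n n" for U :: "complex mat"
    by (rule eq_matI) (use that adj[OF that] adj[OF adj[OF that]] in \<open>auto simp: adj_idx\<close>)
  have adj_mult: "mat_adjoint (U * V) = mat_adjoint V * mat_adjoint U"
    if "U \<in> carrier_mat n n" "V \<in> carrier_mat n n" for U V :: "complex mat"
  proof (rule eq_matI)
    fix i j assume "i < dim_row (mat_adjoint V * mat_adjoint U)"
      and "j < dim_col (mat_adjoint V * mat_adjoint U)"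
    then have ij: "i < n" "j < n" using adj that by auto
    show "mat_adjoint (U * V) $$ (i, j) = (mat_adjoint V * mat_adjoint U) $$ (i, j)"
      using ij that adj[OF that(1)] adj[OF that(2)]
      by (subst adj_idx) (auto simp: scalar_prod_def adj_idx mult.commute)
  qed (use that adj[OF that(1)] adj[OF that(2)] adj[of "U * V"] in auto)
  have adj_one: "mat_adjoint (1\<^sub>m n) = (1\<^sub>m n :: complex mat)"
    by (rule eq_matI) (use adj[of "1\<^sub>m n"] in \<open>auto simp: adj_idx\<close>)
  show "x \<otimes>\<^bsub>unitary_group n\<^esub> y \<in> carrier (unitary_group n)"
    if "x \<in> carrier (unitary_group n)" "y \<in> carrier (unitary_group n)" for x y
  proof -
    have x: "x \<in> carrier_mat n n" "mat_adjoint x * x = 1\<^sub>m n" "x * mat_adjoint x = 1\<^sub>m n"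
      and y: "y \<in> carrier_mat n n" "mat_adjoint y * y = 1\<^sub>m n" "y * mat_adjoint y = 1\<^sub>m n"
      using that by (auto simp: unitary_group_def unitary_mat_def)
    have "mat_adjoint y * mat_adjoint x * (x * y) = mat_adjoint y * (mat_adjoint x * x * y)"
      using x(1) y(1) adj[OF x(1)] adj[OF y(1)] by (simp add: assoc_mult_mat[where ?n\<^sub>2.0 = n and ?n\<^sub>3.0 = n and ?n\<^sub>4.0 = n])
    moreover have "x * y * (mat_adjoint y * mat_adjoint x) = x * (y * mat_adjoint y * mat_adjoint x)"
      using x(1) y(1) adj[OF x(1)] adj[OF y(1)] by (simp add: assoc_mult_mat[where ?n\<^sub>2.0 = n and ?n\<^sub>3.0 = n and ?n\<^sub>4.0 = n])
    ultimately show ?thesis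
      using x y adj[OF x(1)] adj[OF y(1)]
      by (simp add: unitary_group_def unitary_mat_def adj_mult)
  qed
  show "\<exists>y\<in>carrier (unitary_group n). y \<otimes>\<^bsub>unitary_group n\<^esub> x = \<one>\<^bsub>unitary_group n\<^esub>"
    if "x \<in> carrier (unitary_group n)" for x
    using that
    by (intro bexI[of _ "mat_adjoint x"]) (auto simp: unitary_group_def unitary_mat_def adj adj_adj)
  show "\<one>\<^bsub>unitary_group n\<^esub> \<in> carrier (unitary_group n)"
    by (simp add: unitary_group_def unitary_mat_def adj_one)
qed (auto simp: unitary_group_def unitary_mat_def)

lemma tensor_id_tensor_mat:
  assumes A: "A \<in> carrier_mat d d" and B: "B \<in> carrier_mat n n"
    and EA: "E A \<in> carrier_mat d d"
    and hom: "\<And>c. E (c \<cdot>\<^sub>m A) = c \<cdot>\<^sub>m E A"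
  shows "tensor_id d n E (tensor_mat A B) = tensor_mat (E A) B"
proof (rule eq_matI)
  fix i j
  assume "i < dim_row (tensor_mat (E A) B)" "j < dim_col (tensor_mat (E A) B)"
  then have ij: "i < d * n" "j < d * n" using EA B by (auto simp: tensor_mat_def)
  then have n: "n > 0" by (cases n) auto
  have div: "i div n < d" "j div n < d"
    using ij by (auto simp: less_mult_imp_div_less)
  have less: "a * n + r < d * n" if "a < d" "r < n" for a r
  proof -
    have "a * n + r < Suc a * n" using that by simp
    also have "\<dots> \<le> d * n" using that by (intro mult_le_mono1) auto
    finally show ?thesis .
  qed
  have block: "mat d d (\<lambda>(a, b). tensor_mat A B $$ (a * n + i mod n, b * n + j mod n))
      = B $$ (i mod n, j mod n) \<cdot>\<^sub>m A"
    using A B n less by (intro eq_matI) (auto simp: tensor_mat_def)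
  show "tensor_id d n E (tensor_mat A B) $$ (i, j) = tensor_mat (E A) B $$ (i, j)"
    unfolding tensor_id_def using ij div EA B by (simp add: block hom) (simp add: tensor_mat_def)
qed (use EA B in \<open>auto simp: tensor_id_def tensor_mat_def\<close>)

lemma mat_exp_pauli_Z:
  "mat_exp (c \<cdot>\<^sub>m pauli_Z) = mat_of_rows_list 2 [[exp c, 0], [0, exp (- c)]]"
proof -
  let ?D = "\<lambda>x y :: complex. mat_of_rows_list 2 [[x, 0], [0, y]]"
  have D: "?D x y \<in> carrier_mat 2 2" for x y
    by (auto simp: mat_of_rows_list_def)
  have ex: "exp z = (\<Sum>k. z ^ k / fact k)" for z :: complex
    by (simp add: exp_def scaleR_conv_of_real field_simps)
  have cZ: "c \<cdot>\<^sub>m pauli_Z = ?D c (- c)"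
    by (rule eq_matI) (auto simp: pauli_Z_def mat_of_rows_list_def less_Suc_eq numeral_2_eq_2)
  have pow: "?D x y ^\<^sub>m k = ?D (x ^ k) (y ^ k)" for x y k
  proof (induction k)
    case 0
    show ?case by (rule eq_matI) (auto simp: mat_of_rows_list_def less_Suc_eq numeral_2_eq_2)
  next
    case (Suc k)
    show ?case
      unfolding pow_mat.simps Suc
      by (rule eq_matI)
        (auto simp: mat_of_rows_list_def less_Suc_eq numeral_2_eq_2 scalar_prod_def)
  qed
  show ?thesis
    unfolding mat_exp_def cZ pow
    by (rule eq_matI) (auto simp: mat_of_rows_list_def less_Suc_eq numeral_2_eq_2 ex)
qed

end

theory Submission
  imports Defs "HOL-Analysis.L2_Norm"
begin

text \<open>
  Synthesize with accuracy \<open>\<epsilon>\<close> the two axial rotations whose angles lie at distance \<open>\<delta>\<close> on either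
  side of the angle of \<open>V\<close>. Mixing a gate \<open>U\<close> with \<open>Z U Z\<close> removes the interference between its
  diagonal and its antidiagonal part; the latter is a multiple of a unitary and has norm at most \<open>\<epsilon>\<close>.
  For \<open>cos (2 \<delta>) = 2 (1 - \<epsilon>\<^sup>2 / 2)\<^sup>2 - 1\<close> the relative phases of the two diagonal parts lie
  on opposite sides of that of \<open>V\<close>, so some convex combination of the two twirled gates has no net phase error
  and differs from \<open>V\<close> only by terms of order \<open>\<epsilon>\<^sup>2\<close>. This difference is written as a linear
  combination of four unitary channels, and the sum of the absolute values of the coefficients bounds its
  diamond norm. The last step rests on the duality \<open>\<parallel>X\<parallel>\<^sub>1 = max \<bar>tr (K X)\<bar>\<close> over contractions \<open>K\<close>.
\<close>

subsection \<open>Diagonalization of Hermitian matrices\<close>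

lemma mat_adjoint_carrier [simp]: "A \<in> carrier_mat m n \<Longrightarrow> mat_adjoint A \<in> carrier_mat n m"
  unfolding mat_adjoint_def carrier_mat_def by auto

lemma dim_mat_adjoint [simp]: "dim_row (mat_adjoint A) = dim_col A" "dim_col (mat_adjoint A) = dim_row A"
  by (auto simp: mat_adjoint_def)

lemma index_mat_adjoint [simp]:
  "i < dim_col A \<Longrightarrow> j < dim_row A \<Longrightarrow> mat_adjoint A $$ (i, j) = cnj (A $$ (j, i))"
  unfolding mat_adjoint_def by (auto simp: mat_of_rows_index)

lemma mat_adjoint_adjoint [simp]: "mat_adjoint (mat_adjoint A) = (A :: complex mat)"
  by (rule eq_matI) auto

lemma mat_adjoint_mult:
  "A \<in> carrier_mat l m \<Longrightarrow> B \<in> carrier_mat m n \<Longrightarrow>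
    mat_adjoint (A * B) = mat_adjoint B * (mat_adjoint A :: complex mat)"
  by (rule eq_matI) (auto simp: scalar_prod_def mult.commute intro!: sum.cong)

lemma mat_adjoint_one [simp]: "mat_adjoint (1\<^sub>m n) = (1\<^sub>m n :: complex mat)"
  by (rule eq_matI) auto

lemma mat_adjoint_minus:
  "A \<in> carrier_mat m n \<Longrightarrow> B \<in> carrier_mat m n \<Longrightarrow>
    mat_adjoint (A - B) = mat_adjoint A - (mat_adjoint B :: complex mat)"
  by (rule eq_matI) auto

lemma square_mult_carrier [simp]:
  "A \<in> carrier_mat n n \<Longrightarrow> B \<in> carrier_mat n n \<Longrightarrow> A * B \<in> carrier_mat n n"
  by (rule mult_carrier_mat)

lemma square_assoc:
  "A \<in> carrier_mat n n \<Longrightarrow> B \<in> carrier_mat n n \<Longrightarrow> C \<in> carrier_mat n n \<Longrightarrow>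
    A * B * C = A * (B * C :: 'a :: semiring_0 mat)"
  by (rule assoc_mult_mat)

text \<open>A left inverse of a square matrix over a field is also a right inverse, so one equation
  gives both.\<close>

lemma unitary_matI:
  assumes "U \<in> carrier_mat n n" "mat_adjoint U * U = 1\<^sub>m n"
  shows "unitary_mat n U"
  using assms mat_mult_left_right_inverse[of "mat_adjoint U" n U] by (auto simp: unitary_mat_def)

lemma unitary_matD:
  assumes "unitary_mat n U"
  shows "U \<in> carrier_mat n n" "mat_adjoint U * U = 1\<^sub>m n" "U * mat_adjoint U = 1\<^sub>m n"
  using assms by (auto simp: unitary_mat_def)

lemma unitary_mat_adjoint: "unitary_mat n U \<Longrightarrow> unitary_mat n (mat_adjoint U)"
  by (auto simp: unitary_mat_def)

lemma unitary_mat_mult: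
  assumes U: "unitary_mat n U" and V: "unitary_mat n V" shows "unitary_mat n (U * V)"
  using group.subgroup_self[OF group_unitary_group, of n] assms
    subgroup.m_closed[of "carrier (unitary_group n)" "unitary_group n" U V]
  by (simp add: unitary_group_def)

section \<open>Unitary diagonalization\<close>

abbreviation diag_fun :: "nat \<Rightarrow> (nat \<Rightarrow> complex) \<Rightarrow> complex mat" where
  "diag_fun n d \<equiv> mat n n (\<lambda>(i, j). if i = j then d i else 0)"

text \<open>Complete \<open>v\<close> to a basis with \<open>v\<close> in front; Gram-Schmidt keeps
  the first vector and makes the family orthogonal, and normalizing turns it into a unitary. Hence
  column 0 is a multiple of \<open>v\<close>.\<close>

lemma orthonormal_basis_extension:
  fixes v :: "complex vec"
  assumes v: "v \<in> carrier_vec n" and v0: "v \<noteq> 0\<^sub>v n"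
  obtains W c where "unitary_mat n W" "col W 0 = c \<cdot>\<^sub>v v" "c \<noteq> 0"
proof -
  have n: "n \<noteq> 0" using v v0 by auto
  interpret cof_vec_space n "TYPE(complex)" .
  define b where "b = basis_completion v"
  define ws where "ws = gram_schmidt n b"
  from basis_completion[OF v v0, folded b_def]
  have dist_b: "distinct b" 
    and indep: "\<not> lin_dep (set b)" and b: "set b \<subseteq> carrier_vec n" and hdb: "hd b = v" 
    and len_b: "length b = n" by auto
  from hdb len_b n obtain vs where bv: "b = v # vs" by (cases b, auto)
  from gram_schmidt_result[OF b dist_b indep refl, folded ws_def]
  have ws: "set ws \<subseteq> carrier_vec n" "corthogonal ws" "length ws = n" 
    by (auto simp: len_b)
  have "ws ! 0 = v"
    using gram_schmidt_hd[OF v, of vs, folded bv] ws(3) n unfolding ws_def[symmetric]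
    by (cases ws) auto
  \<comment> \<open>Reciprocal lengths; taking \<open>Re\<close> is harmless because the inner
    product of a basis vector with itself is a positive real, see \<open>pos\<close>.\<close>
  define c where "c i = complex_of_real (1 / sqrt (Re (ws ! i \<bullet>c ws ! i)))" for i
  define W where "W = mat n n (\<lambda>(i, j). c j * ws ! j $ i)"
  have wsi: "ws ! i \<in> carrier_vec n" if "i < n" for i using ws that by auto
  have pos: "ws ! i \<bullet>c ws ! i = of_real (Re (ws ! i \<bullet>c ws ! i)) \<and> Re (ws ! i \<bullet>c ws ! i) > 0"
    if "i < n" for i
  proof -
    have nz: "ws ! i \<bullet>c ws ! i \<noteq> 0" using ws that corthogonalD[OF ws(2), of i i] by auto
    have "ws ! i \<bullet>c ws ! i = (\<Sum>k<n. of_real ((cmod (ws ! i $ k))\<^sup>2))"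
      using wsi[OF that]
      by (auto simp: scalar_prod_def complex_norm_square atLeast0LessThan simp del: of_real_power intro!: sum.cong)
    then have *: "ws ! i \<bullet>c ws ! i = of_real (\<Sum>k<n. ((cmod (ws ! i $ k))\<^sup>2))"
      by simp
    have "(\<Sum>k<n. ((cmod (ws ! i $ k))\<^sup>2)) \<ge> 0" by (intro sum_nonneg) auto
    with nz show ?thesis unfolding * by (auto simp: less_le simp del: of_real_sum)
  qed
  have W: "W \<in> carrier_mat n n" by (simp add: W_def)
  have "mat_adjoint W * W = 1\<^sub>m n"
  proof (rule eq_matI)
    fix i j assume "i < dim_row (1\<^sub>m n)" "j < dim_col (1\<^sub>m n)"
    then have ij: "i < n" "j < n" by auto
    have "(mat_adjoint W * W) $$ (i, j) = (\<Sum>k<n. cnj (c i) * c j * (ws ! j $ k * cnj (ws ! i $ k)))"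
      using ij W by (auto simp: scalar_prod_def W_def atLeast0LessThan intro!: sum.cong)
    also have "\<dots> = cnj (c i) * c j * (ws ! j \<bullet>c ws ! i)"
      using wsi[OF ij(1)] wsi[OF ij(2)]
      by (simp add: sum_distrib_left scalar_prod_def atLeast0LessThan)
    also have "\<dots> = 1\<^sub>m n $$ (i, j)"
    proof (cases "i = j")
      case True
      have "cnj (c j) * c j = of_real (1 / Re (ws ! j \<bullet>c ws ! j))"
        using pos[OF ij(2)] unfolding c_def complex_cnj_complex_of_real of_real_mult[symmetric]
        by (simp add: real_sqrt_mult[symmetric])
      then show ?thesis using pos[OF ij(2)] ij True
        by (metis (no_types, lifting) index_one_mat(1) of_real_1 of_real_mult less_irrefl nonzero_eq_divide_eq)
    next
      case False
      then show ?thesis using ij corthogonalD[OF ws(2), of j i] ws by auto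
    qed
    finally show "(mat_adjoint W * W) $$ (i, j) = 1\<^sub>m n $$ (i, j)" .
  qed (use W in auto)
  then have "unitary_mat n W" using W by (rule unitary_matI[rotated])
  moreover have "col W 0 = c 0 \<cdot>\<^sub>v v"
    using n v \<open>ws ! 0 = v\<close> by (intro eq_vecI) (auto simp: W_def)
  moreover have "c 0 \<noteq> 0" using pos[of 0] n by (auto simp: c_def)
  ultimately show ?thesis by (rule that)
qed

lemma eigenvalue_exists:
  assumes A: "(A :: complex mat) \<in> carrier_mat n n" and "n \<noteq> 0"
  shows "\<exists>e. eigenvalue A e"
proof -
  have "degree (char_poly A) = n" using degree_monic_char_poly[OF A] by auto
  then have "\<not> constant (poly (char_poly A))" using \<open>n \<noteq> 0\<close> by (simp add: constant_degree)
  then show ?thesis using fundamental_theorem_of_algebra eigenvalue_root_char_poly[OF A] by auto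
qed

text \<open>Deflation: in an orthonormal basis starting with an eigenvector, the first column and,
  by symmetry, the first row vanish off the diagonal. The induction hypothesis diagonalizes the
  remaining block.\<close>

lemma hermitian_diagonalization:
  fixes A :: "complex mat"
  assumes "A \<in> carrier_mat n n" "mat_adjoint A = A"
  shows "\<exists>P d. unitary_mat n P \<and> mat_adjoint P * A * P = diag_fun n d"
  using assms
proof (induction n arbitrary: A)
  case 0
  show ?case
    by (rule exI[of _ "1\<^sub>m 0"], rule exI[of _ "\<lambda>_. 0"]) (use 0 in \<open>auto simp: unitary_mat_def\<close>)
next
  case (Suc n)
  note A = Suc.prems(1)
  obtain e v where ev: "eigenvector A v e"
    using eigenvalue_exists[OF A] by (auto simp: eigenvalue_def)
  then have v: "v \<in> carrier_vec (Suc n)" "v \<noteq> 0\<^sub>v (Suc n)" and Av: "A *\<^sub>v v = e \<cdot>\<^sub>v v"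
    using A by (auto simp: eigenvector_def)
  obtain W c where U: "unitary_mat (Suc n) W" and col: "col W 0 = c \<cdot>\<^sub>v v" and "c \<noteq> 0"
    by (rule orthonormal_basis_extension[OF v])
  note W = unitary_matD[OF U]
  define B where "B = mat_adjoint W * A * W"
  have B: "B \<in> carrier_mat (Suc n) (Suc n)" using A W by (simp add: B_def)
  have Bh: "mat_adjoint B = B"
    using A W Suc.prems(2) unfolding B_def
    by (simp add: mat_adjoint_mult[of _ "Suc n" "Suc n" _ "Suc n"] square_assoc[of _ "Suc n"])
  \<comment> \<open>Column 0 of \<open>W\<close> is an eigenvector of \<open>A\<close>, so
    \<open>B\<close> maps the first unit vector to \<open>e\<close> times itself.\<close>
  have "col B 0 = (mat_adjoint W * A) *\<^sub>v (c \<cdot>\<^sub>v v)"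
    unfolding B_def using A W col by (subst col_mult2[of _ "Suc n" "Suc n" _ "Suc n"]) auto
  also have "\<dots> = e \<cdot>\<^sub>v (mat_adjoint W *\<^sub>v col W 0)"
    using A W v Av col
    by (simp add: assoc_mult_mat_vec[of _ "Suc n" "Suc n" _ "Suc n"] mult_mat_vec[of _ "Suc n" "Suc n"] smult_smult_assoc mult.commute)
  also have "\<dots> = e \<cdot>\<^sub>v col (1\<^sub>m (Suc n)) 0"
    using W by (subst W(2)[symmetric], subst col_mult2[of _ "Suc n" "Suc n" _ "Suc n"]) auto
  finally have B0: "B $$ (i, 0) = (if i = 0 then e else 0)" if "i < Suc n" for i
    using that B by (metis (no_types, lifting) col_one index_col index_smult_vec(1) carrier_matD index_unit_vec(1,3) mult_zero_right mult.right_neutral zero_less_Suc)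
  have Bsym: "B $$ (j, i) = cnj (B $$ (i, j))" if "i < Suc n" "j < Suc n" for i j
    using that B arg_cong[OF Bh, of "\<lambda>M. M $$ (j, i)"] by simp
  \<comment> \<open>Hermitian symmetry makes the eigenvalue real and clears row 0 along with column
    0.\<close>
  have ee: "cnj e = e" using Bsym[of 0 0] unfolding B0[OF zero_less_Suc] by simp
  have B0': "B $$ (0, i) = (if i = 0 then e else 0)" if "i < Suc n" for i
    by (subst Bsym[OF that]) (auto simp: B0[OF that] ee)
  define B' where "B' = mat n n (\<lambda>(i, j). B $$ (Suc i, Suc j))"
  have B': "B' \<in> carrier_mat n n" by (simp add: B'_def)
  moreover have "mat_adjoint B' = B'"
    by (rule eq_matI) (use B' in \<open>auto simp: B'_def intro!: Bsym[symmetric]\<close>)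
  ultimately obtain P d where P: "unitary_mat n P" and PBP: "mat_adjoint P * B' * P = diag_fun n d"
    using Suc.IH by blast
  note Pc = unitary_matD(1)[OF P]
  have Ps: "(\<Sum>k<n. cnj (P $$ (k, i)) * P $$ (k, j)) = (if i = j then 1 else 0)"
    if "i < n" "j < n" for i j
    using arg_cong[OF unitary_matD(2)[OF P], of "\<lambda>M. M $$ (i, j)"] that Pc
    by (simp add: scalar_prod_def atLeast0LessThan)
  have Pd: "(\<Sum>k<n. (\<Sum>l<n. cnj (P $$ (l, i)) * B $$ (Suc l, Suc k)) * P $$ (k, j)) = (if i = j then d i else 0)"
    if "i < n" "j < n" for i j
    using arg_cong[OF PBP, of "\<lambda>M. M $$ (i, j)"] that Pc B'
    by (simp add: scalar_prod_def atLeast0LessThan B'_def)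
  \<comment> \<open>The block sum of 1 and \<open>P\<close>: it leaves the first coordinate alone
    and diagonalizes the block \<open>B'\<close>.\<close>
  define R where "R = mat (Suc n) (Suc n) (\<lambda>(i, j). case (i, j) of
    (Suc i, Suc j) \<Rightarrow> P $$ (i, j) | (0, 0) \<Rightarrow> 1 | _ \<Rightarrow> 0)"
  have R: "R \<in> carrier_mat (Suc n) (Suc n)" by (simp add: R_def)
  have Ri: "R $$ (0, 0) = 1" "i < n \<Longrightarrow> R $$ (Suc i, 0) = 0" "i < n \<Longrightarrow> R $$ (0, Suc i) = 0"
    "i < n \<Longrightarrow> j < n \<Longrightarrow> R $$ (Suc i, Suc j) = P $$ (i, j)" for i j
    by (auto simp: R_def)
  have RU: "unitary_mat (Suc n) R"
  proof (rule unitary_matI[OF R], rule eq_matI)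
    fix i j assume "i < dim_row (1\<^sub>m (Suc n))" "j < dim_col (1\<^sub>m (Suc n))"
    then show "(mat_adjoint R * R) $$ (i, j) = 1\<^sub>m (Suc n) $$ (i, j)"
      using R Ps
      by (cases i; cases j)
        (auto simp: scalar_prod_def atLeast0LessThan sum.lessThan_Suc_shift Ri simp del: sum.lessThan_Suc)
  qed (use R in auto)
  have RBR: "mat_adjoint R * B * R = diag_fun (Suc n) (\<lambda>i. case i of 0 \<Rightarrow> e | Suc i \<Rightarrow> d i)"
  proof (rule eq_matI)
    fix i j assume "i < dim_row (diag_fun (Suc n) (\<lambda>i. case i of 0 \<Rightarrow> e | Suc i \<Rightarrow> d i))"
      "j < dim_col (diag_fun (Suc n) (\<lambda>i. case i of 0 \<Rightarrow> e | Suc i \<Rightarrow> d i))"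
    then show "(mat_adjoint R * B * R) $$ (i, j) = diag_fun (Suc n) (\<lambda>i. case i of 0 \<Rightarrow> e | Suc i \<Rightarrow> d i) $$ (i, j)"
      using R B Pd
      by (cases i; cases j)
        (auto simp: scalar_prod_def atLeast0LessThan sum.lessThan_Suc_shift Ri B0 B0' simp del: sum.lessThan_Suc)
  qed (use R B in auto)
  have "mat_adjoint (W * R) * A * (W * R) = mat_adjoint R * B * R"
    using R W A by (simp add: B_def mat_adjoint_mult[of _ "Suc n" "Suc n" _ "Suc n"] square_assoc[of _ "Suc n"])
  with RBR unitary_mat_mult[OF U RU] show ?case by (intro exI[of _ "W * R"] exI conjI) (assumption, simp only:)
qed

subsection \<open>Trace norm duality\<close>

definition col_sqnorm :: "complex mat \<Rightarrow> nat \<Rightarrow> real" where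
  "col_sqnorm M j = (\<Sum>i<dim_row M. (cmod (M $$ (i, j)))\<^sup>2)"

definition mat_trace :: "complex mat \<Rightarrow> complex" where
  "mat_trace A = (\<Sum>i<dim_row A. A $$ (i, i))"

(* Testing on the columns of square matrices spares a separate calculus of vector norms. *)
definition contraction_mat :: "nat \<Rightarrow> complex mat \<Rightarrow> bool" where
  "contraction_mat n K \<longleftrightarrow> K \<in> carrier_mat n n \<and>
     (\<forall>M\<in>carrier_mat n n. \<forall>j<n. col_sqnorm (K * M) j \<le> col_sqnorm M j)"

lemma col_sqnorm_nonneg [simp]: "0 \<le> col_sqnorm M j"
  by (simp add: col_sqnorm_def sum_nonneg)

text \<open>This turns identities between Gram matrices into identities between squared column
  lengths.\<close>

lemma adjoint_mult_self_diag:
  "M \<in> carrier_mat m n \<Longrightarrow> j < n \<Longrightarrow> (mat_adjoint M * M) $$ (j, j) = complex_of_real (col_sqnorm M j)"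
  unfolding col_sqnorm_def of_real_sum complex_norm_square
  by (auto simp: scalar_prod_def atLeast0LessThan mult.commute intro!: sum.cong)

lemma contraction_mat_mult:
  assumes "contraction_mat n K" "contraction_mat n L"
  shows "contraction_mat n (K * L)"
  unfolding contraction_mat_def
proof (intro conjI ballI allI impI)
  have K: "K \<in> carrier_mat n n" and L: "L \<in> carrier_mat n n"
    using assms by (auto simp: contraction_mat_def)
  then show "K * L \<in> carrier_mat n n" by simp
  fix M :: "complex mat" and j assume M: "M \<in> carrier_mat n n" and j: "j < n"
  have "col_sqnorm (K * (L * M)) j \<le> col_sqnorm (L * M) j"
    using assms(1) L M j unfolding contraction_mat_def by (blast intro: square_mult_carrier)
  also have "\<dots> \<le> col_sqnorm M j" using assms(2) M j by (auto simp: contraction_mat_def)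
  finally show "col_sqnorm (K * L * M) j \<le> col_sqnorm M j"
    using K L M by (simp add: square_assoc[of _ n])
qed

lemma col_sqnorm_unitary_mult:
  assumes U: "unitary_mat n U" and M: "M \<in> carrier_mat n n" and j: "j < n"
  shows "col_sqnorm (U * M) j = col_sqnorm M j"
proof -
  note u = unitary_matD[OF U]
  have "mat_adjoint (U * M) * (U * M) = mat_adjoint M * (mat_adjoint U * U * M)"
    using u(1) M by (simp add: mat_adjoint_mult[of _ n n _ n] square_assoc[of _ n])
  also have "\<dots> = mat_adjoint M * M" using M by (simp add: u(2))
  finally show ?thesis
    using adjoint_mult_self_diag[of "U * M" n n j] adjoint_mult_self_diag[of M n n j] u(1) M j by simp
qed

lemma contraction_mat_unitary: "unitary_mat n U \<Longrightarrow> contraction_mat n U"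
  by (simp add: contraction_mat_def col_sqnorm_unitary_mult unitary_matD(1))

text \<open>The equation makes \<open>F\<close> a partial isometry, so \<open>F\<close> times its
  adjoint is an orthogonal projection. By Pythagoras the projection \<open>G\<close> of
  \<open>M\<close> has columns no longer than those of \<open>M\<close>, and they are as long as
  those of the adjoint of \<open>F\<close> applied to \<open>M\<close>.\<close>

lemma contraction_mat_adjoint_partial_isometry:
  assumes F: "F \<in> carrier_mat n n" and FFF: "F * (mat_adjoint F * F) = F"
  shows "contraction_mat n (mat_adjoint F)"
  unfolding contraction_mat_def
proof (intro conjI ballI allI impI)
  show "mat_adjoint F \<in> carrier_mat n n" using F by simp
  fix M :: "complex mat" and j assume M: "M \<in> carrier_mat n n" and j: "j < n"
  define N where "N = mat_adjoint F * M"
  have N: "N \<in> carrier_mat n n" using F M by (simp add: N_def)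
  have FN: "mat_adjoint (F * N) * M = mat_adjoint N * N"
    using F M N by (simp add: N_def mat_adjoint_mult[of _ n n _ n] square_assoc[of _ n])
  have MFN: "mat_adjoint M * (F * N) = mat_adjoint N * N"
    using F M N by (simp add: N_def mat_adjoint_mult[of _ n n _ n] square_assoc[of _ n])
  \<comment> \<open>The projection fixes \<open>F * N\<close>.\<close>
  have "F * (mat_adjoint F * (F * N)) = F * (mat_adjoint F * F) * N"
    using F N by (simp add: square_assoc[of _ n])
  then have FFN: "F * (mat_adjoint F * (F * N)) = F * N" by (simp add: FFF)
  have NN: "mat_adjoint (F * N) * (F * N) = mat_adjoint N * N"
    using F M N FFN
    by (simp add: N_def mat_adjoint_mult[of _ n n _ n] square_assoc[of _ n])
  define G where "G = F * N"
  note G = G_def[symmetric]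
  have Gc: "G \<in> carrier_mat n n" using F N by (simp add: G_def)
  \<comment> \<open>All three products that involve \<open>G\<close> equal the Gram matrix of
    \<open>N\<close>, so it survives once, with a minus sign.\<close>
  have "mat_adjoint (M - G) * (M - G) = mat_adjoint M * (M - G) - mat_adjoint G * (M - G)"
    unfolding mat_adjoint_minus[OF M Gc] using M Gc by (intro minus_mult_distrib_mat) auto
  also have "mat_adjoint M * (M - G) = mat_adjoint M * M - mat_adjoint N * N"
    using M Gc MFN by (simp add: mult_minus_distrib_mat[of _ n n] G)
  also have "mat_adjoint G * (M - G) = mat_adjoint N * N - mat_adjoint N * N"
    using M Gc FN NN by (simp add: mult_minus_distrib_mat[of _ n n] G)
  finally have "(mat_adjoint (M - G) * (M - G)) $$ (j, j) = (mat_adjoint M * M) $$ (j, j) - (mat_adjoint N * N) $$ (j, j)"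
    using M N j by (simp del: index_mult_mat add: index_mult_mat(2,3))
  then have "complex_of_real (col_sqnorm (M - F * N) j) = of_real (col_sqnorm M j) - of_real (col_sqnorm N j)"
    using F M N Gc j
    by (simp add: adjoint_mult_self_diag[of _ n n] adjoint_mult_self_diag[of "M - G" n n] minus_carrier_mat G del: index_mult_mat)
  then have "col_sqnorm (M - F * N) j = col_sqnorm M j - col_sqnorm N j"
    unfolding of_real_diff[symmetric] of_real_eq_iff .
  then show "col_sqnorm (mat_adjoint F * M) j \<le> col_sqnorm M j"
    using col_sqnorm_nonneg[of "M - F * N" j] by (simp add: N_def)
qed

lemma mat_trace_commute:
  "A \<in> carrier_mat m n \<Longrightarrow> B \<in> carrier_mat n m \<Longrightarrow> mat_trace (A * B) = mat_trace (B * A)"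
  unfolding mat_trace_def
  by (auto simp: scalar_prod_def atLeast0LessThan mult.commute sum.swap[of _ "{..<m}"])

section \<open>Singular values from the diagonalized Gram matrix\<close>

lemma proots_linear_factors: "proots (\<Prod>a\<leftarrow>as. [:- a, 1:]) = mset (as :: 'a :: idom list)"
proof (induction as)
  case (Cons a as)
  have "(\<Prod>a\<leftarrow>as. [:- a, 1:]) \<noteq> (0 :: 'a poly)" by auto
  with Cons show ?case
    by (simp del: mult_pCons_left add: proots_mult)
qed simp

text \<open>\<open>P\<close> diagonalizes the Gram matrix of \<open>X\<close>. The columns of
  \<open>X * P\<close> are then orthogonal and their lengths are the singular values: similar
  matrices share the characteristic polynomial, and that of a diagonal matrix displays its roots
  with multiplicity.\<close>

lemma singular_values_right_basis:
  assumes X: "X \<in> carrier_mat n n"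
  obtains P s where "unitary_mat n P" "\<And>i. 0 \<le> s i"
    "mat_adjoint (X * P) * (X * P) = diag_fun n (\<lambda>i. of_real ((s i)\<^sup>2))"
    "singular_values X = image_mset s (mset_set {..<n})"
proof -
  define H where "H = mat_adjoint X * X"
  have H: "H \<in> carrier_mat n n" "mat_adjoint H = H"
    using X by (auto simp: H_def mat_adjoint_mult[of _ n n _ n])
  obtain P d where P: "unitary_mat n P" and D: "mat_adjoint P * H * P = diag_fun n d"
    using hermitian_diagonalization[OF H] by blast
  note p = unitary_matD[OF P]
  \<comment> \<open>As a column length, \<open>s i\<close> is nonnegative for every
    \<open>i\<close>; its square is the eigenvalue \<open>d i\<close> when
    \<open>i < n\<close>.\<close>
  define s where "s i = sqrt (col_sqnorm (X * P) i)" for i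
  have XP: "mat_adjoint (X * P) * (X * P) = diag_fun n d"
    using X p unfolding D[symmetric] by (simp add: H_def mat_adjoint_mult[of _ n n _ n] square_assoc[of _ n])
  have d: "d i = of_real ((s i)\<^sup>2)" if "i < n" for i
    using adjoint_mult_self_diag[of "X * P" n n i] X p that by (simp add: XP s_def del: index_mult_mat of_real_power)
  have DD: "diag_fun n d = diag_fun n (\<lambda>i. of_real ((s i)\<^sup>2))" (is "_ = ?D")
    by (rule eq_matI) (auto simp: d simp del: of_real_power)
  have "similar_mat_wit ?D H (mat_adjoint P) P"
    by (rule similar_mat_witI[of _ _ n]) (use p H D DD in auto)
  then have "char_poly H = char_poly ?D"
    using char_poly_similar[of ?D H] unfolding similar_mat_def by fastforce
  also have "\<dots> = (\<Prod>a\<leftarrow>diag_mat ?D. [:- a, 1:])"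
    by (rule char_poly_upper_triangular[of _ n]) (auto simp: upper_triangular_def)
  also have "diag_mat ?D = map (\<lambda>i. of_real ((s i)\<^sup>2)) [0..<n]"
    by (auto simp: diag_mat_def)
  finally have "proots (char_poly H) = mset (map (\<lambda>i. of_real ((s i)\<^sup>2)) [0..<n])"
    by (simp only:) (subst proots_linear_factors, simp)
  then have "singular_values X = image_mset (\<lambda>i. sqrt ((s i)\<^sup>2)) (mset [0..<n])"
    unfolding singular_values_def H_def[symmetric]
    by (simp add: image_mset.compositionality o_def del: of_real_power real_sqrt_abs)
  also have "mset [0..<n] = mset_set {..<n}"
    by (simp add: atLeast0LessThan)
  also have "(\<lambda>i. sqrt ((s i)\<^sup>2)) = s"
    by (rule ext) (simp add: s_def)
  finally have "singular_values X = image_mset s (mset_set {..<n})" .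
  then show ?thesis
    by (intro that[of P s]) (auto simp: P XP DD s_def simp del: of_real_power)
qed

lemma trace_norm_eq_sum:
  "singular_values X = image_mset s (mset_set {..<n}) \<Longrightarrow> trace_norm X = (\<Sum>i<n. s i)"
  by (simp add: trace_norm_def sum_unfold_sum_mset)

text \<open>In the basis \<open>P\<close> the trace is a sum of inner products of column
  \<open>j\<close> of \<open>P\<close>, of length 1, with column \<open>j\<close> of
  \<open>K * (X * P)\<close>, of length at most \<open>s j\<close>. Cauchy-Schwarz bounds each by
  \<open>s j\<close>.\<close>

lemma cmod_trace_mult_le_trace_norm:
  assumes K: "contraction_mat n K" and X: "X \<in> carrier_mat n n"
  shows "cmod (mat_trace (K * X)) \<le> trace_norm X"
proof -
  obtain P s where P: "unitary_mat n P" and s: "\<And>i. 0 \<le> s i"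
    and D: "mat_adjoint (X * P) * (X * P) = diag_fun n (\<lambda>i. of_real ((s i)\<^sup>2))"
    and sv: "singular_values X = image_mset s (mset_set {..<n})"
    by (rule singular_values_right_basis[OF X]) blast
  note p = unitary_matD[OF P]
  have Kc: "K \<in> carrier_mat n n" using K by (simp add: contraction_mat_def)
  define Y where "Y = K * (X * P)"
  have Y: "Y \<in> carrier_mat n n" using Kc X p by (simp add: Y_def)
  have "mat_trace (K * X) = mat_trace (K * X * P * mat_adjoint P)"
    using Kc X p by (simp add: square_assoc[of _ n])
  also have "\<dots> = mat_trace (mat_adjoint P * Y)"
    using Kc X p by (subst mat_trace_commute[of _ n n]) (auto simp: Y_def square_assoc[of _ n])
  finally have "cmod (mat_trace (K * X)) \<le> (\<Sum>j<n. cmod ((mat_adjoint P * Y) $$ (j, j)))"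
    using p Y by (simp add: mat_trace_def norm_sum)
  also have "\<dots> \<le> (\<Sum>j<n. s j)"
  proof (intro sum_mono)
    fix j assume "j \<in> {..<n}"
    then have j: "j < n" by simp
    have "complex_of_real (col_sqnorm P j) = 1"
      using adjoint_mult_self_diag[of P n n j] p j by simp
    then have P1: "col_sqnorm P j = 1" by simp
    have "complex_of_real (col_sqnorm (X * P) j) = of_real ((s j)\<^sup>2)"
      using adjoint_mult_self_diag[of "X * P" n n j] X p j by (simp add: D del: index_mult_mat of_real_power)
    then have XP: "col_sqnorm (X * P) j = (s j)\<^sup>2"
      unfolding of_real_eq_iff .
    have "col_sqnorm Y j \<le> (s j)\<^sup>2"
      using K X p j unfolding Y_def XP[symmetric] contraction_mat_def by simp
    then have Ys: "sqrt (col_sqnorm Y j) \<le> s j"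
      using s[of j] real_le_lsqrt by simp
    have "(mat_adjoint P * Y) $$ (j, j) = (\<Sum>i<n. cnj (P $$ (i, j)) * Y $$ (i, j))"
      using p Y j by (simp add: scalar_prod_def atLeast0LessThan)
    then have "cmod ((mat_adjoint P * Y) $$ (j, j)) \<le> (\<Sum>i<n. cmod (P $$ (i, j)) * cmod (Y $$ (i, j)))"
      by (metis (no_types, lifting) norm_sum norm_mult complex_mod_cnj sum.cong)
    also have "\<dots> \<le> sqrt (col_sqnorm P j) * sqrt (col_sqnorm Y j)"
      using L2_set_mult_ineq[of "\<lambda>i. cmod (P $$ (i, j))" "\<lambda>i. cmod (Y $$ (i, j))" "{..<n}"] p Y
      by (simp add: L2_set_def col_sqnorm_def)
    also have "\<dots> \<le> s j" using P1 Ys by simp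
    finally show "cmod ((mat_adjoint P * Y) $$ (j, j)) \<le> s j" .
  qed
  finally show ?thesis by (simp add: trace_norm_eq_sum[OF sv])
qed

text \<open>The nonzero columns of \<open>X * P\<close>, divided by their lengths, form a partial
  isometry \<open>F\<close>. Pairing \<open>X * P\<close> with the adjoint of \<open>F\<close>
  leaves the \<open>s i\<close> on the diagonal, and cyclicity of the trace moves \<open>P\<close>
  to the front.\<close>

lemma trace_norm_attained:
  assumes X: "X \<in> carrier_mat n n"
  obtains Q where "contraction_mat n Q" "mat_trace (Q * X) = of_real (trace_norm X)"
proof -
  obtain P s where P: "unitary_mat n P" and s: "\<And>i. 0 \<le> s i"
    and D: "mat_adjoint (X * P) * (X * P) = diag_fun n (\<lambda>i. of_real ((s i)\<^sup>2))"
    and sv: "singular_values X = image_mset s (mset_set {..<n})"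
    by (rule singular_values_right_basis[OF X]) blast
  note p = unitary_matD[OF P]
  \<comment> \<open>The convention \<open>inverse 0 = 0\<close> covers vanishing singular values:
    their columns in \<open>F\<close> are zero.\<close>
  define S where "S = diag_fun n (\<lambda>i. of_real (inverse (s i)))"
  define F where "F = X * P * S"
  have S: "S \<in> carrier_mat n n" "mat_adjoint S = S"
    by (auto simp: S_def intro!: eq_matI)
  have F: "F \<in> carrier_mat n n" using X p S by (simp add: F_def)
  have diag_mult: "diag_fun n f * diag_fun n g = diag_fun n (\<lambda>i. f i * g i)" for f g
    by (rule eq_matI) (auto simp: scalar_prod_def atLeast0LessThan if_distrib cong: if_cong)
  have FXP: "mat_adjoint F * (X * P) = S * diag_fun n (\<lambda>i. of_real ((s i)\<^sup>2))"
    using X p S D[symmetric] by (simp add: F_def mat_adjoint_mult[of _ n n _ n] square_assoc[of _ n])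
  have "mat_adjoint F * F = mat_adjoint F * (X * P) * S"
    using X p S F by (simp add: F_def square_assoc[of _ n])
  then have "mat_adjoint F * F = S * diag_fun n (\<lambda>i. of_real ((s i)\<^sup>2)) * S"
    by (simp add: FXP)
  \<comment> \<open>On the diagonal this is the cube of \<open>inverse (s i)\<close> times the
    square of \<open>s i\<close>, which is \<open>inverse (s i)\<close> also for
    \<open>s i = 0\<close>.\<close>
  then have "S * (mat_adjoint F * F) = S * (S * diag_fun n (\<lambda>i. of_real ((s i)\<^sup>2)) * S)" by simp
  then have "S * (mat_adjoint F * F) = S"
    unfolding S_def diag_mult by (auto intro!: eq_matI simp: power2_eq_square divide_simps)
  then have "F * (mat_adjoint F * F) = F"
    using X p S F unfolding F_def by (simp add: square_assoc[of _ n])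
  then have "contraction_mat n (P * mat_adjoint F)"
    using P F by (intro contraction_mat_mult contraction_mat_unitary contraction_mat_adjoint_partial_isometry)
  moreover have "mat_trace (P * mat_adjoint F * X) = mat_trace (S * diag_fun n (\<lambda>i. of_real ((s i)\<^sup>2)))"
    using X p F by (simp add: FXP[symmetric] square_assoc[of _ n] mat_trace_commute[of P n n])
  moreover have "\<dots> = of_real (trace_norm X)"
    unfolding S_def diag_mult trace_norm_eq_sum[OF sv] mat_trace_def of_real_sum
    by (rule sum.cong) (auto simp: power2_eq_square divide_simps)
  ultimately show ?thesis by (intro that[of "P * mat_adjoint F"]) simp_all
qed

text \<open>Supplies a member of the set whose supremum is the diamond norm.\<close>

lemma trace_norm_zero: "trace_norm (0\<^sub>m n n) = 0"
proof -
  obtain Q where "contraction_mat n Q" "mat_trace (Q * 0\<^sub>m n n) = of_real (trace_norm (0\<^sub>m n n))"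
    by (rule trace_norm_attained[OF zero_carrier_mat])
  moreover from this have "Q * 0\<^sub>m n n = 0\<^sub>m n n"
    by (intro right_mult_zero_mat) (simp add: contraction_mat_def)
  ultimately show ?thesis by (simp add: mat_trace_def)
qed

text \<open>Column \<open>j\<close> is the image of a unit vector. In the eigenbasis of the Gram
  matrix its squared length is an average of the squared singular values, weighted by the unit
  column \<open>j\<close> of \<open>R\<close>.\<close>

lemma col_sqnorm_le_op_norm:
  assumes X: "X \<in> carrier_mat n n" and j: "j < n"
  shows "col_sqnorm X j \<le> (op_norm X)\<^sup>2"
proof -
  obtain P s where P: "unitary_mat n P" and s: "\<And>i. 0 \<le> s i"
    and D: "mat_adjoint (X * P) * (X * P) = diag_fun n (\<lambda>i. of_real ((s i)\<^sup>2))"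
    and sv: "singular_values X = image_mset s (mset_set {..<n})"
    by (rule singular_values_right_basis[OF X]) blast
  note p = unitary_matD[OF P]
  have op: "s i \<le> op_norm X" if "i < n" for i
    using that by (simp add: op_norm_def sv)
  define R where "R = mat_adjoint P"
  have R: "R \<in> carrier_mat n n" "unitary_mat n R" using p P by (simp_all add: R_def unitary_mat_adjoint)
  have "X * P * R = X" using X p by (simp add: R_def square_assoc[of _ n])
  then have "mat_adjoint X * X = mat_adjoint (X * P * R) * (X * P * R)" by simp
  also have "\<dots> = mat_adjoint R * (mat_adjoint (X * P) * (X * P)) * R"
    using X p R by (simp add: mat_adjoint_mult[of _ n n _ n] square_assoc[of _ n])
  finally have "complex_of_real (col_sqnorm X j) = (mat_adjoint R * diag_fun n (\<lambda>i. of_real ((s i)\<^sup>2)) * R) $$ (j, j)"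
    using X j by (simp add: adjoint_mult_self_diag[symmetric, of _ n n] D del: index_mult_mat of_real_power)
  also have "\<dots> = of_real (\<Sum>k<n. (s k)\<^sup>2 * (cmod (R $$ (k, j)))\<^sup>2)"
    unfolding of_real_sum of_real_mult complex_norm_square using R j
    by (auto simp: scalar_prod_def atLeast0LessThan if_distrib mult_ac cong: if_cong intro!: sum.cong)
  finally have "col_sqnorm X j = (\<Sum>k<n. (s k)\<^sup>2 * (cmod (R $$ (k, j)))\<^sup>2)"
    unfolding of_real_eq_iff .
  also have "\<dots> \<le> (\<Sum>k<n. (op_norm X)\<^sup>2 * (cmod (R $$ (k, j)))\<^sup>2)"
    using op s by (intro sum_mono mult_right_mono power_mono) auto
  also have "\<dots> = (op_norm X)\<^sup>2 * col_sqnorm R j"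
    using R by (simp add: col_sqnorm_def sum_distrib_left)
  also have "complex_of_real (col_sqnorm R j) = 1"
    using adjoint_mult_self_diag[of R n n j] unitary_matD(2)[OF R(2)] R j by simp
  then have "col_sqnorm R j = 1" by simp
  finally show ?thesis by simp
qed

subsection \<open>Diamond norm of combinations of unitary channels\<close>

lemma sum_lessThan_mult:
  fixes f :: "nat \<Rightarrow> 'a :: comm_monoid_add"
  shows "(\<Sum>k<d * n. f k) = (\<Sum>a<d. \<Sum>r<n. f (a * n + r))"
proof -
  have "sum f {a * n..<a * n + n} = (\<Sum>r<n. f (a * n + r))" for a
    by (rule sum.reindex_bij_witness[of _ "\<lambda>r. a * n + r" "\<lambda>k. k - a * n"]) auto
  then show ?thesis by (simp add: sum.nat_group[symmetric])
qed

lemma mult_add_less: "a < d \<Longrightarrow> r < n \<Longrightarrow> a * n + r < d * (n :: nat)"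
  using mult_le_mono1[of "Suc a" d n] by simp

abbreviation ampliation :: "nat \<Rightarrow> complex mat \<Rightarrow> complex mat" where
  "ampliation n U \<equiv> tensor_mat U (1\<^sub>m n)"

lemma dim_tensor_mat [simp]:
  "dim_row (tensor_mat A B) = dim_row A * dim_row B" "dim_col (tensor_mat A B) = dim_col A * dim_col B"
  by (simp_all add: tensor_mat_def)

lemma ampliation_carrier [simp]: "U \<in> carrier_mat d d \<Longrightarrow> ampliation n U \<in> carrier_mat (d * n) (d * n)"
  by (auto simp: tensor_mat_def)

lemma index_ampliation:
  assumes "U \<in> carrier_mat d d" "i < d * n" "j < d * n"
  shows "ampliation n U $$ (i, j) = (if i mod n = j mod n then U $$ (i div n, j div n) else 0)"
proof -
  have "n > 0" using assms by (cases n) auto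
  then show ?thesis using assms by (auto simp: tensor_mat_def)
qed

lemma ampliation_mult:
  assumes U: "U \<in> carrier_mat d d" and V: "V \<in> carrier_mat d d"
  shows "ampliation n U * ampliation n V = ampliation n (U * V)"
proof (rule eq_matI)
  fix i j assume "i < dim_row (ampliation n (U * V))" "j < dim_col (ampliation n (U * V))"
  then have ij: "i < d * n" "j < d * n" using U V by (auto simp: tensor_mat_def)
  then have n: "n > 0" by (cases n) auto
  have dm: "i div n < d" "j div n < d" "i mod n < n" using ij n by (auto simp: less_mult_imp_div_less)
  have "(ampliation n U * ampliation n V) $$ (i, j) =
      (\<Sum>k<d * n. ampliation n U $$ (i, k) * ampliation n V $$ (k, j))"
    using ij U V by (simp add: scalar_prod_def atLeast0LessThan)
  also have "\<dots> = (\<Sum>a<d. \<Sum>r<n. ampliation n U $$ (i, a * n + r) * ampliation n V $$ (a * n + r, j))"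
    by (rule sum_lessThan_mult)
  also have "\<dots> = (\<Sum>a<d. \<Sum>r<n. if r = i mod n then
      (if i mod n = j mod n then U $$ (i div n, a) * V $$ (a, j div n) else 0) else 0)"
    using ij by (intro sum.cong refl) (auto simp: index_ampliation[OF U] index_ampliation[OF V] mult_add_less)
  also have "\<dots> = (\<Sum>a<d. if i mod n = j mod n then U $$ (i div n, a) * V $$ (a, j div n) else 0)"
    using dm by simp
  also have "\<dots> = ampliation n (U * V) $$ (i, j)"
    using ij dm U V by (auto simp: index_ampliation[of _ d] scalar_prod_def atLeast0LessThan)
  finally show "(ampliation n U * ampliation n V) $$ (i, j) = ampliation n (U * V) $$ (i, j)" .
qed (use U V in \<open>auto simp: tensor_mat_def\<close>)

lemma ampliation_adjoint:
  assumes U: "U \<in> carrier_mat d d"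
  shows "mat_adjoint (ampliation n U) = ampliation n (mat_adjoint U)"
proof (rule eq_matI)
  fix i j assume "i < dim_row (ampliation n (mat_adjoint U))" "j < dim_col (ampliation n (mat_adjoint U))"
  then have ij: "i < d * n" "j < d * n" using U by (auto simp: tensor_mat_def)
  then have "i div n < d" "j div n < d" by (auto simp: less_mult_imp_div_less)
  then show "mat_adjoint (ampliation n U) $$ (i, j) = ampliation n (mat_adjoint U) $$ (i, j)"
    using ij U by (auto simp: index_ampliation[of _ d])
qed (use U in \<open>auto simp: tensor_mat_def\<close>)

lemma ampliation_one: "ampliation n (1\<^sub>m d) = 1\<^sub>m (d * n)"
proof (rule eq_matI)
  fix i j assume "i < dim_row (1\<^sub>m (d * n) :: complex mat)" "j < dim_col (1\<^sub>m (d * n) :: complex mat)"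
  then have ij: "i < d * n" "j < d * n" by auto
  then have "i div n < d" "j div n < d" by (auto simp: less_mult_imp_div_less)
  moreover have "i = j \<longleftrightarrow> i div n = j div n \<and> i mod n = j mod n"
    by (metis div_mod_decomp)
  ultimately show "ampliation n (1\<^sub>m d) $$ (i, j) = 1\<^sub>m (d * n) $$ (i, j)"
    using ij by (simp add: index_ampliation[of _ d])
qed (auto simp: tensor_mat_def)

lemma unitary_ampliation:
  assumes "unitary_mat d U" shows "unitary_mat (d * n) (ampliation n U)"
  using unitary_matD[OF assms]
  by (intro unitary_matI) (simp_all add: ampliation_adjoint ampliation_mult[of _ d] ampliation_one)

text \<open>The identity factor of the ampliation keeps exactly the summands whose ancilla indices
  are those of \<open>i\<close> and \<open>j\<close>, which is the block that
  \<open>tensor_id\<close> selects. Diamond norm bounds thus reduce to trace norm bounds for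
  conjugations in the larger space.\<close>

lemma tensor_id_unitary_channel:
  assumes U: "U \<in> carrier_mat d d" and X: "X \<in> carrier_mat (d * n) (d * n)"
  shows "tensor_id d n (unitary_channel U) X = unitary_channel (ampliation n U) X"
proof (rule eq_matI)
  let ?T = "ampliation n U"
  fix i j assume "i < dim_row (unitary_channel ?T X)" "j < dim_col (unitary_channel ?T X)"
  then have ij: "i < d * n" "j < d * n" using U by (auto simp: unitary_channel_def)
  then have n: "n > 0" by (cases n) auto
  have dm: "i div n < d" "j div n < d" "i mod n < n" "j mod n < n"
    using ij n by (auto simp: less_mult_imp_div_less)
  have "unitary_channel ?T X $$ (i, j) = (\<Sum>l<d * n. (\<Sum>k<d * n. ?T $$ (i, k) * X $$ (k, l)) * cnj (?T $$ (j, l)))"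
    using ij U X by (simp add: unitary_channel_def scalar_prod_def atLeast0LessThan)
  also have "\<dots> = (\<Sum>b<d. \<Sum>s<n. (\<Sum>a<d. \<Sum>r<n. ?T $$ (i, a * n + r) * X $$ (a * n + r, b * n + s)) * cnj (?T $$ (j, b * n + s)))"
    by (simp add: sum_lessThan_mult)
  also have "\<dots> = (\<Sum>b<d. \<Sum>s<n. if s = j mod n then (\<Sum>a<d. \<Sum>r<n. if r = i mod n then
      U $$ (i div n, a) * X $$ (a * n + i mod n, b * n + j mod n) else 0) * cnj (U $$ (j div n, b)) else 0)"
    using ij
    by (intro sum.cong refl) (auto simp: index_ampliation[OF U] mult_add_less if_distrib[of "\<lambda>x. x * _"]
        intro!: sum.cong arg_cong2[of _ _ _ _ "(*)"] cong: if_cong)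
  also have "\<dots> = (\<Sum>b<d. (\<Sum>a<d. U $$ (i div n, a) * X $$ (a * n + i mod n, b * n + j mod n)) * cnj (U $$ (j div n, b)))"
    using dm by simp
  also have "\<dots> = tensor_id d n (unitary_channel U) X $$ (i, j)"
    using ij dm U by (simp add: tensor_id_def unitary_channel_def scalar_prod_def atLeast0LessThan)
  finally show "tensor_id d n (unitary_channel U) X $$ (i, j) = unitary_channel ?T X $$ (i, j)" by simp
qed (use U in \<open>auto simp: tensor_id_def unitary_channel_def tensor_mat_def\<close>)

text \<open>Triangle inequality and unitary invariance in one, by duality: for \<open>Q\<close>
  attaining the norm of \<open>Y\<close>, the trace splits linearly, and in each term the
  conjugation by \<open>U k\<close> moves from \<open>X\<close> to \<open>Q\<close>, which remains a
  contraction.\<close>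

lemma trace_norm_unitary_combination_le:
  assumes U: "\<And>k. k \<in> J \<Longrightarrow> unitary_mat n (U k)"
    and X: "X \<in> carrier_mat n n" and Y: "Y \<in> carrier_mat n n"
    and YX: "\<And>i j. i < n \<Longrightarrow> j < n \<Longrightarrow> Y $$ (i, j) = (\<Sum>k\<in>J. c k * unitary_channel (U k) X $$ (i, j))"
  shows "trace_norm Y \<le> (\<Sum>k\<in>J. cmod (c k)) * trace_norm X"
proof -
  obtain Q where Q: "contraction_mat n Q" and tr: "mat_trace (Q * Y) = of_real (trace_norm Y)"
    by (rule trace_norm_attained[OF Y])
  then have Qc: "Q \<in> carrier_mat n n" by (simp add: contraction_mat_def)
  have uc: "unitary_channel (U k) X \<in> carrier_mat n n" if "k \<in> J" for k
    using unitary_matD(1)[OF U[OF that]] X by (simp add: unitary_channel_def)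
  have "mat_trace (Q * Y) = (\<Sum>i<n. \<Sum>l<n. Q $$ (i, l) * (\<Sum>k\<in>J. c k * unitary_channel (U k) X $$ (l, i)))"
    using Qc Y by (simp add: mat_trace_def scalar_prod_def atLeast0LessThan YX)
  also have "\<dots> = (\<Sum>k\<in>J. c k * (\<Sum>i<n. \<Sum>l<n. Q $$ (i, l) * unitary_channel (U k) X $$ (l, i)))"
    by (simp add: sum_distrib_left mult_ac sum.swap[of _ J])
  also have "\<dots> = (\<Sum>k\<in>J. c k * mat_trace (Q * unitary_channel (U k) X))"
  proof (intro sum.cong refl)
    fix k assume "k \<in> J"
    then show "c k * (\<Sum>i<n. \<Sum>l<n. Q $$ (i, l) * unitary_channel (U k) X $$ (l, i)) =
        c k * mat_trace (Q * unitary_channel (U k) X)"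
      using Qc uc[of k] by (simp add: mat_trace_def scalar_prod_def atLeast0LessThan)
  qed
  finally have "cmod (mat_trace (Q * Y)) \<le> (\<Sum>k\<in>J. cmod (c k) * cmod (mat_trace (Q * unitary_channel (U k) X)))"
    by (simp add: norm_sum norm_mult[symmetric])
  also have "\<dots> \<le> (\<Sum>k\<in>J. cmod (c k) * trace_norm X)"
  proof (intro sum_mono mult_left_mono)
    fix k assume k: "k \<in> J"
    note u = unitary_matD[OF U[OF k]]
    have "contraction_mat n (mat_adjoint (U k) * (Q * U k))"
      using U[OF k] Q contraction_mat_mult contraction_mat_unitary unitary_mat_adjoint by blast
    then have "cmod (mat_trace (mat_adjoint (U k) * (Q * U k) * X)) \<le> trace_norm X"
      using X by (rule cmod_trace_mult_le_trace_norm)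
    moreover have "mat_trace (Q * unitary_channel (U k) X) = mat_trace (mat_adjoint (U k) * (Q * U k) * X)"
      using u Qc X mat_trace_commute[of "Q * (U k * X)" n n "mat_adjoint (U k)"]
      by (simp add: unitary_channel_def square_assoc[of _ n])
    ultimately show "cmod (mat_trace (Q * unitary_channel (U k) X)) \<le> trace_norm X" by simp
  qed auto
  finally show ?thesis
    unfolding tr norm_of_real sum_distrib_right[symmetric] by linarith
qed

text \<open>Ampliations of unitaries are unitary, so one bound serves every ancilla dimension. The
  hypothesis is entrywise because \<open>tensor_id\<close> feeds single blocks to \<open>F\<close>
  and reads off entries.\<close>

lemma diamond_norm_unitary_combination_le:
  assumes U: "\<And>k. k \<in> J \<Longrightarrow> unitary_mat d (U k)"
    and F: "\<And>\<rho> i j. \<rho> \<in> carrier_mat d d \<Longrightarrow> i < d \<Longrightarrow> j < d \<Longrightarrow>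
      F \<rho> $$ (i, j) = (\<Sum>k\<in>J. c k * unitary_channel (U k) \<rho> $$ (i, j))"
  shows "diamond_norm d F \<le> (\<Sum>k\<in>J. cmod (c k))"
  unfolding diamond_norm_def
proof (rule cSup_least)
  \<comment> \<open>\<open>cSup_least\<close> requires a nonempty set; the zero input with a
    one-dimensional ancilla is the witness.\<close>
  have "trace_norm (tensor_id d 1 F (0\<^sub>m (d * 1) (d * 1))) \<in> {trace_norm (tensor_id d n F X) | n X.
      n > 0 \<and> X \<in> carrier_mat (d * n) (d * n) \<and> trace_norm X \<le> 1}"
    by (rule CollectI, intro exI conjI, rule refl) (auto simp: trace_norm_zero)
  then show "{trace_norm (tensor_id d n F X) | n X.
      n > 0 \<and> X \<in> carrier_mat (d * n) (d * n) \<and> trace_norm X \<le> 1} \<noteq> {}" by blast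
next
  fix y assume "y \<in> {trace_norm (tensor_id d n F X) | n X.
      n > 0 \<and> X \<in> carrier_mat (d * n) (d * n) \<and> trace_norm X \<le> 1}"
  then obtain n X where y: "y = trace_norm (tensor_id d n F X)"
    and X: "X \<in> carrier_mat (d * n) (d * n)" and X1: "trace_norm X \<le> 1" by blast
  have "y \<le> (\<Sum>k\<in>J. cmod (c k)) * trace_norm X"
    unfolding y
  proof (rule trace_norm_unitary_combination_le[OF unitary_ampliation X])
    show "tensor_id d n F X \<in> carrier_mat (d * n) (d * n)" by (simp add: tensor_id_def)
    fix i j assume ij: "i < d * n" "j < d * n"
    then have dm: "i div n < d" "j div n < d" by (auto simp: less_mult_imp_div_less)
    have "tensor_id d n F X $$ (i, j) = (\<Sum>k\<in>J. c k * tensor_id d n (unitary_channel (U k)) X $$ (i, j))"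
      using ij dm by (simp add: tensor_id_def F)
    also have "\<dots> = (\<Sum>k\<in>J. c k * unitary_channel (ampliation n (U k)) X $$ (i, j))"
      using U X by (intro sum.cong refl) (simp add: tensor_id_unitary_channel unitary_matD(1))
    finally show "tensor_id d n F X $$ (i, j) = (\<Sum>k\<in>J. c k * unitary_channel (ampliation n (U k)) X $$ (i, j))" .
  qed (rule U)
  also have "\<dots> \<le> (\<Sum>k\<in>J. cmod (c k))"
    using X1 mult_left_le[of "trace_norm X" "\<Sum>k\<in>J. cmod (c k)"] by (simp add: sum_nonneg)
  finally show "y \<le> (\<Sum>k\<in>J. cmod (c k))" .
qed

subsection \<open>Twirled mixtures of two qubit gates\<close>

text \<open>Modulus at most 1 and real part at least \<open>a\<close> confine the phases of
  \<open>w\<close> and \<open>w'\<close> to arccos \<open>a\<close>, hence that of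
  \<open>w * cnj w'\<close> to twice this angle. By the double angle formula it is the angle of
  \<open>Complex c s\<close>, at most a right angle, so rotating by it leads into the upper half
  plane. The surplus \<open>1 - r\<close> in the second bound later pays for the antidiagonal
  part.\<close>

lemma rotated_product_bounds:
  fixes w w' :: complex
  assumes r: "(cmod w)\<^sup>2 = r" "(cmod w')\<^sup>2 = r" "r \<le> 1"
    and a: "0 \<le> a" "a \<le> Re w" "a \<le> Re w'"
    and c: "c = 2 * a\<^sup>2 - 1" "0 \<le> c" and s: "0 \<le> s" "s\<^sup>2 = 1 - c\<^sup>2"
  shows "0 \<le> Im (w * cnj w' * Complex c s)"
    and "1 - 2 * s\<^sup>2 + (1 - r) \<le> Re (w * cnj w' * Complex c s)"
proof -
  define m where "m = w * cnj w'"
  have r0: "0 \<le> r" unfolding r(1)[symmetric] by simp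
  have c1: "c \<le> 1" using s(2) abs_square_le_1[of c] zero_le_power2[of s] by auto
  have sq: "a\<^sup>2 \<le> (Re w)\<^sup>2" "a\<^sup>2 \<le> (Re w')\<^sup>2" "a\<^sup>2 \<le> Re w * Re w'"
    using a by (auto intro!: power_mono mult_mono simp: power2_eq_square)
  have "2 * \<bar>Im w * Im w'\<bar> \<le> (Im w)\<^sup>2 + (Im w')\<^sup>2"
    using sum_squares_bound[of "\<bar>Im w\<bar>" "\<bar>Im w'\<bar>"] by (simp add: abs_mult)
  moreover have "(Re w)\<^sup>2 + (Im w)\<^sup>2 = r" "(Re w')\<^sup>2 + (Im w')\<^sup>2 = r"
    using r by (simp_all add: cmod_power2)
  moreover have "Re m = Re w * Re w' + Im w * Im w'" by (simp add: m_def)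
  \<comment> \<open>The product of the imaginary parts is bounded by the mean of their squares,
    which are \<open>r\<close> minus the squared real parts.\<close>
  ultimately have x: "c + 1 - r \<le> Re m" using sq unfolding c(1) by linarith
  have "0 \<le> (1 - r) * (1 + c)" using r(3) c(2) by simp
  \<comment> \<open>As \<open>m\<close> has modulus \<open>r\<close>, this says for
    \<open>r > 0\<close> that the cosine of its phase is at least \<open>c\<close>.\<close>
  then have xr: "c * r \<le> Re m" using x by (simp add: algebra_simps)
  have "(cmod m)\<^sup>2 = r\<^sup>2"
    using r by (simp add: m_def norm_mult power_mult_distrib power2_eq_square[of r])
  then have "(Re m)\<^sup>2 + (Im m)\<^sup>2 = r\<^sup>2" by (simp only: cmod_power2)
  moreover have "(c * r)\<^sup>2 \<le> (Re m)\<^sup>2" using xr c(2) r0 by (intro power_mono) auto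
  moreover have "(s * r)\<^sup>2 = r\<^sup>2 - (c * r)\<^sup>2"
    unfolding power_mult_distrib s(2) by (simp add: algebra_simps)
  ultimately have "(Im m)\<^sup>2 \<le> (s * r)\<^sup>2" by linarith
  then have y: "\<bar>Im m\<bar> \<le> s * r"
    using s(1) r0 by (metis abs_le_square_iff abs_of_nonneg mult_nonneg_nonneg)
  have "c * \<bar>Im m\<bar> \<le> c * (s * r)" and "s * (c * r) \<le> s * Re m"
    using y xr c s by (auto intro!: mult_left_mono)
  moreover have "c * - \<bar>Im m\<bar> \<le> c * Im m" using c(2) by (intro mult_left_mono) auto
  ultimately show "0 \<le> Im (w * cnj w' * Complex c s)"
    unfolding m_def[symmetric] by (simp add: algebra_simps)
  have "c * (c + 1 - r) \<le> c * Re m" using x c(2) by (rule mult_left_mono)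
  moreover have "s * Im m \<le> s * (s * r)" using y s(1) by (intro mult_left_mono) auto
  moreover have "0 \<le> (1 - r) * (c * (1 - c))" using r(3) c(2) c1 by simp
  \<comment> \<open>The lower bounds for the two terms of the real part add up to the claim plus the
    nonnegative slack found just before.\<close>
  moreover have "c * (c + 1 - r) - s * (s * r) = 1 - 2 * s\<^sup>2 + (1 - r) + (1 - r) * (c * (1 - c))"
  proof -
    have "s * (s * r) = (1 - c\<^sup>2) * r"
      using s(2) by (simp add: power2_eq_square flip: mult.assoc)
    then show ?thesis unfolding s(2) by (simp add: algebra_simps power2_eq_square)
  qed
  moreover have "Re (m * Complex c s) = c * Re m - s * Im m" by simp
  ultimately show "1 - 2 * s\<^sup>2 + (1 - r) \<le> Re (w * cnj w' * Complex c s)"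
    unfolding m_def[symmetric] by linarith
qed

text \<open>Provides the mixing weight that cancels two phase errors of opposite sign, as the root
  of an affine function. If \<open>x = y\<close>, both vanish and 0 is taken.\<close>

lemma convex_combination_zero:
  fixes x y :: real
  assumes "0 \<le> x" "y \<le> 0"
  obtains p where "0 \<le> p" "p \<le> 1" "p * x + (1 - p) * y = 0"
proof (cases "x = y")
  case True
  then show ?thesis using assms that[of 0] by simp
next
  case False
  then show ?thesis
    using assms by (intro that[of "- y / (x - y)"]) (auto simp: field_simps)
qed

section \<open>Entrywise calculus of 2 by 2 matrices\<close>

abbreviation mat2 :: "complex \<Rightarrow> complex \<Rightarrow> complex \<Rightarrow> complex \<Rightarrow> complex mat" where
  "mat2 a b c d \<equiv> mat_of_rows_list 2 [[a, b], [c, d]]"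

lemma mat2_carrier [simp]: "mat2 a b c d \<in> carrier_mat 2 2"
  by (auto simp: mat_of_rows_list_def)

lemma dim_mat2 [simp]: "dim_row (mat2 a b c d) = 2" "dim_col (mat2 a b c d) = 2"
  by (auto simp: mat_of_rows_list_def)

lemma index_mat2 [simp]:
  "mat2 a b c d $$ (0, 0) = a" "mat2 a b c d $$ (0, 1) = b"
  "mat2 a b c d $$ (1, 0) = c" "mat2 a b c d $$ (1, 1) = d"
  "mat2 a b c d $$ (0, Suc 0) = b"
  "mat2 a b c d $$ (Suc 0, 0) = c" "mat2 a b c d $$ (Suc 0, Suc 0) = d"
  by (auto simp: mat_of_rows_list_def)

lemma mat2_eqI:
  assumes "A \<in> carrier_mat 2 2" "B \<in> carrier_mat 2 2"
    "A $$ (0, 0) = B $$ (0, 0)" "A $$ (0, 1) = B $$ (0, 1)"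
    "A $$ (1, 0) = B $$ (1, 0)" "A $$ (1, 1) = B $$ (1, 1)"
  shows "A = B"
  using assms by (intro eq_matI) (auto simp: less_2_cases_iff)

lemma mat2_cases:
  assumes "A \<in> carrier_mat 2 2"
  obtains a b c d where "A = mat2 a b c d"
  by (rule that[of "A $$ (0, 0)" "A $$ (0, 1)" "A $$ (1, 0)" "A $$ (1, 1)"])
    (rule mat2_eqI, use assms in auto)

lemma sum_lessThan_2: "(\<Sum>i<2::nat. f i) = f 0 + (f 1 :: 'a :: comm_monoid_add)"
  by (simp add: numeral_2_eq_2)

lemma mat2_mult:
  "mat2 a b c d * mat2 a' b' c' d' = mat2 (a * a' + b * c') (a * b' + b * d') (c * a' + d * c') (c * b' + d * d')"
  by (rule mat2_eqI) (auto simp: scalar_prod_def atLeast0LessThan sum_lessThan_2)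

lemma mat2_adjoint: "mat_adjoint (mat2 a b c d) = mat2 (cnj a) (cnj c) (cnj b) (cnj d)"
  by (rule mat2_eqI) auto

lemma mat2_one: "1\<^sub>m 2 = mat2 1 0 0 1"
  by (rule mat2_eqI) auto

lemma mat2_eq_iff: "mat2 a b c d = mat2 a' b' c' d' \<longleftrightarrow> a = a' \<and> b = b' \<and> c = c' \<and> d = d'"
  by (metis index_mat2(1-4))

text \<open>Normalization of the first row and of both columns expresses every modulus through that
  of \<open>x\<close>.\<close>

lemma unitary_mat2_entries:
  assumes "unitary_mat 2 (mat2 u x y v)"
  shows "(cmod u)\<^sup>2 = 1 - (cmod x)\<^sup>2" "(cmod v)\<^sup>2 = 1 - (cmod x)\<^sup>2" "(cmod y)\<^sup>2 = (cmod x)\<^sup>2"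
proof -
  have "u * cnj u + x * cnj x = 1" "cnj u * u + cnj y * y = 1" "cnj x * x + cnj v * v = 1"
    using unitary_matD(2,3)[OF assms] by (auto simp: mat2_adjoint mat2_mult mat2_one mat2_eq_iff)
  then have "complex_of_real ((cmod u)\<^sup>2 + (cmod x)\<^sup>2) = of_real 1"
    "complex_of_real ((cmod u)\<^sup>2 + (cmod y)\<^sup>2) = of_real 1"
    "complex_of_real ((cmod x)\<^sup>2 + (cmod v)\<^sup>2) = of_real 1"
    unfolding of_real_add complex_norm_square by (simp_all add: mult.commute)
  then show "(cmod u)\<^sup>2 = 1 - (cmod x)\<^sup>2" "(cmod v)\<^sup>2 = 1 - (cmod x)\<^sup>2" "(cmod y)\<^sup>2 = (cmod x)\<^sup>2"
    unfolding of_real_eq_iff by linarith+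
qed

text \<open>Permits squaring the accuracy bound; \<open>n > 0\<close> makes \<open>Max\<close> range
  over a nonempty set.\<close>

lemma op_norm_nonneg:
  assumes X: "X \<in> carrier_mat n n" and n: "n > 0" shows "0 \<le> op_norm X"
proof -
  obtain P s where s: "\<And>i. 0 \<le> s i" and sv: "singular_values X = image_mset s (mset_set {..<n})"
    by (rule singular_values_right_basis[OF X]) blast
  have "s 0 \<le> op_norm X" using n by (simp add: op_norm_def sv)
  with s[of 0] show ?thesis by simp
qed

text \<open>Each column of the difference has squared length at most
  \<open>\<epsilon>\<^sup>2\<close>. It is a difference of unit vectors, so this squared length is 2
  minus twice the real part in question.\<close>

lemma unitary_mat2_near_diagonal:
  assumes U: "unitary_mat 2 (mat2 u x y v)" and a: "cmod a = 1"
    and le: "op_norm (mat2 u x y v - mat2 a 0 0 (cnj a)) \<le> \<epsilon>"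
  shows "1 - \<epsilon>\<^sup>2 / 2 \<le> Re (u * cnj a)" "1 - \<epsilon>\<^sup>2 / 2 \<le> Re (v * a)"
proof -
  define M where "M = mat2 u x y v - mat2 a 0 0 (cnj a)"
  have M: "M \<in> carrier_mat 2 2" unfolding M_def by (intro minus_carrier_mat) simp
  have "(op_norm M)\<^sup>2 \<le> \<epsilon>\<^sup>2"
    using le op_norm_nonneg[OF M] unfolding M_def[symmetric] by (intro power_mono) auto
  then have "col_sqnorm M 0 \<le> \<epsilon>\<^sup>2" "col_sqnorm M 1 \<le> \<epsilon>\<^sup>2"
    using col_sqnorm_le_op_norm[OF M, of 0] col_sqnorm_le_op_norm[OF M, of 1] by auto
  then have "(cmod (u - a))\<^sup>2 + (cmod y)\<^sup>2 \<le> \<epsilon>\<^sup>2" "(cmod x)\<^sup>2 + (cmod (v - cnj a))\<^sup>2 \<le> \<epsilon>\<^sup>2"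
    by (simp_all add: col_sqnorm_def M_def sum_lessThan_2)
  moreover have "(cmod (u - a))\<^sup>2 = (cmod u)\<^sup>2 + (cmod a)\<^sup>2 - 2 * Re (u * cnj a)"
    "(cmod (v - cnj a))\<^sup>2 = (cmod v)\<^sup>2 + (cmod a)\<^sup>2 - 2 * Re (v * a)"
    unfolding cmod_power2 by (simp_all add: power2_eq_square algebra_simps)
  ultimately show "1 - \<epsilon>\<^sup>2 / 2 \<le> Re (u * cnj a)" "1 - \<epsilon>\<^sup>2 / 2 \<le> Re (v * a)"
    using unitary_mat2_entries[OF U] a by auto
qed

lemma unitary_channel_mat2:
  "unitary_channel (mat2 a b c d) (mat2 p q r t) = mat2
    ((a * p + b * r) * cnj a + (a * q + b * t) * cnj b) ((a * p + b * r) * cnj c + (a * q + b * t) * cnj d)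
    ((c * p + d * r) * cnj a + (c * q + d * t) * cnj b) ((c * p + d * r) * cnj c + (c * q + d * t) * cnj d)"
  by (simp add: unitary_channel_def mat2_adjoint mat2_mult)

text \<open>An antidiagonal matrix with entries of equal modulus is that modulus times a unitary.
  For \<open>x = 0\<close> both sides vanish and the identity serves as \<open>Q\<close>.\<close>

lemma antidiagonal_unitary:
  assumes "cmod x = cmod y"
  obtains Q where "unitary_mat 2 Q"
    "\<And>p q r t i j. i < 2 \<Longrightarrow> j < 2 \<Longrightarrow>
      of_real ((cmod x)\<^sup>2) * unitary_channel Q (mat2 p q r t) $$ (i, j) =
      unitary_channel (mat2 0 x y 0) (mat2 p q r t) $$ (i, j)"
proof (cases "x = 0")
  case True
  then show ?thesis using assms
    by (intro that[of "1\<^sub>m 2"]) (auto simp: unitary_mat_def unitary_channel_mat2 less_2_cases_iff)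
next
  case False
  define c where "c = complex_of_real (cmod x)"
  have c: "c \<noteq> 0" "cnj c = c" "c * c = x * cnj x" "c * c = y * cnj y" "of_real ((cmod x)\<^sup>2) = c * c"
    using False complex_norm_square[of x] complex_norm_square[of y] assms
    by (auto simp: c_def power2_eq_square)
  have n: "x * cnj x / (c * c) = 1" "y * cnj y / (c * c) = 1"
    using c by (metis divide_self mult_eq_0_iff)+
  have "unitary_mat 2 (mat2 0 (x / c) (y / c) 0)"
    using n by (intro unitary_matI) (simp_all add: mat2_adjoint mat2_mult mat2_one c(2) mult.commute)
  moreover have "of_real ((cmod x)\<^sup>2) * unitary_channel (mat2 0 (x / c) (y / c) 0) (mat2 p q r t) $$ (i, j) =
      unitary_channel (mat2 0 x y 0) (mat2 p q r t) $$ (i, j)" if "i < 2" "j < 2" for p q r t i j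
    using that c(1) unfolding c(5) by (auto simp: unitary_channel_mat2 less_2_cases_iff c(2))
  ultimately show ?thesis by (rule that)
qed

section \<open>Twirling with the Pauli matrix Z\<close>

lemma pauli_Z_mat2: "pauli_Z = mat2 1 0 0 (- 1)"
  by (simp add: pauli_Z_def)

lemma pauli_Z_conjugate: "pauli_Z * mat2 u x y v * pauli_Z = mat2 u (- x) (- y) v"
  by (simp add: pauli_Z_mat2 mat2_mult)

text \<open>Averaging a gate with its conjugate by \<open>pauli_Z\<close>, which flips the sign of
  the antidiagonal part, cancels the cross terms of the channel. \<open>twirled_weights\<close>
  splits the weight equally within each pair.\<close>

definition twirled_pair :: "complex mat \<Rightarrow> complex mat \<Rightarrow> nat \<Rightarrow> complex mat" where
  "twirled_pair U U' = (\<lambda>k. if k = 1 then U else if k = 2 then pauli_Z * U * pauli_Z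
     else if k = 3 then U' else pauli_Z * U' * pauli_Z)"

definition twirled_weights :: "real \<Rightarrow> nat \<Rightarrow> real" where
  "twirled_weights p = (\<lambda>k. (if k \<le> 2 then p else 1 - p) / 2)"

lemma sum_1_to_4: "(\<Sum>k\<in>{1..4::nat}. f k) = f 1 + f 2 + f 3 + (f 4 :: 'a :: comm_monoid_add)"
proof -
  have "{1..4::nat} = {1, 2, 3, 4}" by auto
  then show ?thesis by (simp add: add.assoc)
qed

text \<open>After twirling, the diagonal parts scale the diagonal of the input by
  \<open>1 - \<eta>\<close> and give its off-diagonal entries \<open>z\<close> times their target
  values, without phase error as \<open>z\<close> is real. The deviation is thus a combination of
  conjugations by the target, by the target times \<open>pauli_Z\<close>, and by the two normalized
  antidiagonal parts.\<close>

lemma diamond_norm_twirled_mixture_le: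
  assumes U: "unitary_mat 2 (mat2 u x y v)" and U': "unitary_mat 2 (mat2 u' x' y' v')"
    and a: "cmod a = 1" and p: "0 \<le> p" "p \<le> 1"
    and \<eta>: "\<eta> = p * (cmod x)\<^sup>2 + (1 - p) * (cmod x')\<^sup>2"
    and z: "of_real p * (u * cnj v) + of_real (1 - p) * (u' * cnj v') = of_real z * a\<^sup>2" "z \<le> 1 - \<eta>"
  shows "diamond_norm 2 (\<lambda>\<rho>. mixed_unitary_channel 2 {1..4} (twirled_weights p)
      (twirled_pair (mat2 u x y v) (mat2 u' x' y' v')) \<rho> - unitary_channel (mat2 a 0 0 (cnj a)) \<rho>)
    \<le> 1 - z + \<eta>"
proof -
  note e = unitary_mat2_entries[OF U] and e' = unitary_mat2_entries[OF U']
  obtain Q where Q: "unitary_mat 2 Q"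
    and Qx: "\<And>p q r t i j. i < 2 \<Longrightarrow> j < 2 \<Longrightarrow>
      of_real ((cmod x)\<^sup>2) * unitary_channel Q (mat2 p q r t) $$ (i, j) =
      unitary_channel (mat2 0 x y 0) (mat2 p q r t) $$ (i, j)"
    by (rule antidiagonal_unitary[of x y]) (use e(3) in auto)
  obtain Q' where Q': "unitary_mat 2 Q'"
    and Qx': "\<And>p q r t i j. i < 2 \<Longrightarrow> j < 2 \<Longrightarrow>
      of_real ((cmod x')\<^sup>2) * unitary_channel Q' (mat2 p q r t) $$ (i, j) =
      unitary_channel (mat2 0 x' y' 0) (mat2 p q r t) $$ (i, j)"
    by (rule antidiagonal_unitary[of x' y']) (use e'(3) in auto)
  define w where "w = z - 1 + \<eta>"
  define W where "W = (\<lambda>k::nat. if k = 1 then mat2 a 0 0 (cnj a) else if k = 2 then mat2 a 0 0 (- cnj a)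
    else if k = 3 then Q else Q')"
  \<comment> \<open>Conjugation by \<open>W 2\<close> negates the off-diagonal target values, so the
    first two coefficients solve \<open>c 1 + c 2 = - \<eta>\<close> and
    \<open>c 1 - c 2 = z - 1\<close>. The other two are the antidiagonal weights, with sum
    \<eta>.\<close>
  define c where "c = (\<lambda>k::nat. complex_of_real (if k = 1 then w / 2 - \<eta> else if k = 2 then - w / 2
    else if k = 3 then p * (cmod x)\<^sup>2 else (1 - p) * (cmod x')\<^sup>2))"
  have aa: "a * cnj a = 1" using complex_norm_square[of a] a by simp
  have cnjz: "of_real p * (v * cnj u) + of_real (1 - p) * (v' * cnj u') = of_real z * (cnj a)\<^sup>2"
    using arg_cong[OF z(1), of cnj] by (simp add: mult.commute)
  have "complex_of_real ((cmod u)\<^sup>2) = 1 - of_real ((cmod x)\<^sup>2)" "complex_of_real ((cmod v)\<^sup>2) = 1 - of_real ((cmod x)\<^sup>2)"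
    "complex_of_real ((cmod u')\<^sup>2) = 1 - of_real ((cmod x')\<^sup>2)" "complex_of_real ((cmod v')\<^sup>2) = 1 - of_real ((cmod x')\<^sup>2)"
    unfolding e e' by simp_all
  then have uv: "u * cnj u = 1 - of_real ((cmod x)\<^sup>2)" "v * cnj v = 1 - of_real ((cmod x)\<^sup>2)"
    "u' * cnj u' = 1 - of_real ((cmod x')\<^sup>2)" "v' * cnj v' = 1 - of_real ((cmod x')\<^sup>2)"
    unfolding complex_norm_square by simp_all
  have "diamond_norm 2 (\<lambda>\<rho>. mixed_unitary_channel 2 {1..4} (twirled_weights p)
      (twirled_pair (mat2 u x y v) (mat2 u' x' y' v')) \<rho> - unitary_channel (mat2 a 0 0 (cnj a)) \<rho>)
      \<le> (\<Sum>k\<in>{1..4}. cmod (c k))"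
  proof (rule diamond_norm_unitary_combination_le[where U = W])
    have "unitary_mat 2 (mat2 a 0 0 (cnj a))" "unitary_mat 2 (mat2 a 0 0 (- cnj a))"
      using aa by (auto intro!: unitary_matI simp: mat2_adjoint mat2_mult mat2_one mult.commute)
    then show "unitary_mat 2 (W k)" for k using Q Q' by (simp add: W_def)
  next
    fix \<rho> :: "complex mat" and i j :: nat
    assume "\<rho> \<in> carrier_mat 2 2" and ij: "i < 2" "j < 2"
    then obtain q00 q01 q10 q11 where \<rho>: "\<rho> = mat2 q00 q01 q10 q11" by (elim mat2_cases)
    \<comment> \<open>With these names the ring identities below treat the real coefficients as
      indeterminates.\<close>
    define P H N :: complex where "P = of_real p" and "H = of_real (w / 2)" and "N = of_real \<eta>"
    define S S' :: complex where "S = of_real ((cmod x)\<^sup>2)" and "S' = of_real ((cmod x')\<^sup>2)"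
    note uv = uv[folded S_def S'_def]
    have N: "N = P * S + (1 - P) * S'" by (simp add: N_def P_def S_def S'_def \<eta>)
    have "of_real z = 1 + 2 * H - N" by (simp add: H_def N_def w_def field_simps)
    then have Z: "P * (u * cnj v) + (1 - P) * (u' * cnj v') = (1 + 2 * H - N) * a\<^sup>2"
      and Z': "P * (v * cnj u) + (1 - P) * (v' * cnj u') = (1 + 2 * H - N) * (cnj a)\<^sup>2"
      using z(1) cnjz by (simp_all add: P_def)
    let ?L = "\<lambda>i j. P * (unitary_channel (mat2 u 0 0 v) \<rho> $$ (i, j) + unitary_channel (mat2 0 x y 0) \<rho> $$ (i, j))
        + (1 - P) * (unitary_channel (mat2 u' 0 0 v') \<rho> $$ (i, j) + unitary_channel (mat2 0 x' y' 0) \<rho> $$ (i, j))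
        - unitary_channel (mat2 a 0 0 (cnj a)) \<rho> $$ (i, j)"
    let ?R = "\<lambda>i j. (H - N) * unitary_channel (mat2 a 0 0 (cnj a)) \<rho> $$ (i, j)
        - H * unitary_channel (mat2 a 0 0 (- cnj a)) \<rho> $$ (i, j)
        + P * unitary_channel (mat2 0 x y 0) \<rho> $$ (i, j)
        + (1 - P) * unitary_channel (mat2 0 x' y' 0) \<rho> $$ (i, j)"
    \<comment> \<open>The twirl: cross terms between diagonal and antidiagonal parts occur with both
      signs and cancel.\<close>
    have "(mixed_unitary_channel 2 {1..4} (twirled_weights p)
        (twirled_pair (mat2 u x y v) (mat2 u' x' y' v')) \<rho> - unitary_channel (mat2 a 0 0 (cnj a)) \<rho>) $$ (i, j)
        = ?L i j"
      using ij unfolding \<rho> mixed_unitary_channel_def sum_1_to_4 twirled_pair_def pauli_Z_conjugate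
      by (auto simp: less_2_cases_iff twirled_weights_def unitary_channel_mat2 P_def field_simps)
    also have "?L i j = ?R i j"
    proof -
      \<comment> \<open>In each entry the difference has a factor that vanishes: by unitarity on the
        diagonal, by the phase condition off it.\<close>
      have "?L 0 0 - ?R 0 0 = (P * (u * cnj u) + (1 - P) * (u' * cnj u') - (1 - N) * (a * cnj a)) * q00"
        unfolding \<rho> unitary_channel_mat2 index_mat2 by (simp add: algebra_simps)
      also have "\<dots> = 0" unfolding uv aa N by (simp add: algebra_simps)
      finally have 00: "?L 0 0 = ?R 0 0" by (simp only: right_minus_eq)
      have "?L 0 1 - ?R 0 1 = (P * (u * cnj v) + (1 - P) * (u' * cnj v') - (1 + 2 * H - N) * a\<^sup>2) * q01"
        unfolding \<rho> unitary_channel_mat2 index_mat2 by (simp add: algebra_simps power2_eq_square)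
      also have "\<dots> = 0" unfolding Z by simp
      finally have 01: "?L 0 1 = ?R 0 1" by (simp only: right_minus_eq)
      have "?L 1 0 - ?R 1 0 = (P * (v * cnj u) + (1 - P) * (v' * cnj u') - (1 + 2 * H - N) * (cnj a)\<^sup>2) * q10"
        unfolding \<rho> unitary_channel_mat2 index_mat2 by (simp add: algebra_simps power2_eq_square)
      also have "\<dots> = 0" unfolding Z' by simp
      finally have 10: "?L 1 0 = ?R 1 0" by (simp only: right_minus_eq)
      have "?L 1 1 - ?R 1 1 = (P * (v * cnj v) + (1 - P) * (v' * cnj v') - (1 - N) * (a * cnj a)) * q11"
        unfolding \<rho> unitary_channel_mat2 index_mat2 by (simp add: algebra_simps)
      also have "\<dots> = 0" unfolding uv aa N by (simp add: algebra_simps)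
      finally have 11: "?L 1 1 = ?R 1 1" by (simp only: right_minus_eq)
      have "i = 0 \<or> i = 1" "j = 0 \<or> j = 1" using ij by linarith+
      then show ?thesis using 00 01 10 11 by (elim disjE) (simp_all only:)
    qed
    also have "\<dots> = (\<Sum>k\<in>{1..4}. c k * unitary_channel (W k) \<rho> $$ (i, j))"
      unfolding \<rho> Qx[OF ij, symmetric] Qx'[OF ij, symmetric] sum_1_to_4
      by (simp add: c_def W_def P_def H_def N_def mult_ac)
    finally show "(mixed_unitary_channel 2 {1..4} (twirled_weights p)
        (twirled_pair (mat2 u x y v) (mat2 u' x' y' v')) \<rho> - unitary_channel (mat2 a 0 0 (cnj a)) \<rho>) $$ (i, j)
        = (\<Sum>k\<in>{1..4}. c k * unitary_channel (W k) \<rho> $$ (i, j))" .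
  qed
  also have "\<dots> = 1 - z + \<eta>"
  proof -
    \<comment> \<open>The signs are now determined: the first coefficient is nonpositive, the others
      are nonnegative.\<close>
    have pos: "0 \<le> p * (cmod x)\<^sup>2" "0 \<le> (1 - p) * (cmod x')\<^sup>2" using p by auto
    then have "w \<le> 0" "0 \<le> \<eta>" using z(2) unfolding w_def \<eta> by linarith+
    have "(\<Sum>k\<in>{1..4}. cmod (c k)) = \<bar>w / 2 - \<eta>\<bar> + \<bar>- w / 2\<bar> + \<bar>p * (cmod x)\<^sup>2\<bar> + \<bar>(1 - p) * (cmod x')\<^sup>2\<bar>"
      unfolding sum_1_to_4 c_def norm_of_real by (simp only: if_True if_False simp_thms numeral_eq_one_iff numeral_eq_iff one_eq_numeral_iff num.distinct num.inject semiring_norm)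
    also have "\<dots> = (\<eta> - w / 2) + (- w / 2) + \<eta>"
      using pos \<open>w \<le> 0\<close> \<open>0 \<le> \<eta>\<close> unfolding \<eta> by linarith
    also have "\<dots> = 1 - z + \<eta>" by (simp add: w_def field_simps)
    finally show ?thesis .
  qed
  finally show ?thesis .
qed

section \<open>Gate words and their costs\<close>

lemma foldr_mult_carrier:
  "set Ws \<subseteq> carrier_mat n n \<Longrightarrow> foldr (*) Ws (1\<^sub>m n) \<in> carrier_mat n n"
  by (induction Ws) auto

text \<open>Moves the start value of \<open>foldr\<close> out as a right factor, so that a gate can
  be appended to a word.\<close>

lemma foldr_mult_right:
  fixes M :: "'a :: semiring_1 mat"
  assumes "set Ws \<subseteq> carrier_mat n n" "M \<in> carrier_mat n n"
  shows "foldr (*) Ws M = foldr (*) Ws (1\<^sub>m n) * M"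
  using assms
proof (induction Ws)
  case (Cons W Ws)
  then show ?case using foldr_mult_carrier[of Ws n] by (simp add: square_assoc[of _ n])
qed simp

text \<open>A word for \<open>U\<close> framed by two copies of the free gate \<open>pauli_Z\<close>
  has the same cost.\<close>

lemma cost_at_most_pauli_Z_conjugate:
  assumes G: "G \<subseteq> carrier (unitary_group 2)" and Z: "pauli_Z \<in> G" "C pauli_Z = 0"
    and U: "cost_at_most 2 G C t U"
  shows "cost_at_most 2 G C t (pauli_Z * U * pauli_Z)"
proof -
  have Gc: "G \<subseteq> carrier_mat 2 2" using G by (auto simp: unitary_group_def unitary_mat_def)
  obtain Ws where Ws: "set Ws \<subseteq> G" "U = foldr (*) Ws (1\<^sub>m 2)" "sum_list (map C Ws) \<le> t"
    using U by (auto simp: cost_at_most_def)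
  have Zc: "pauli_Z \<in> carrier_mat 2 2" using Z Gc by auto
  have "pauli_Z * U * pauli_Z = foldr (*) (pauli_Z # Ws @ [pauli_Z]) (1\<^sub>m 2)"
    using Ws(1) Gc Zc foldr_mult_right[of Ws 2 pauli_Z] foldr_mult_carrier[of Ws 2]
    by (auto simp: Ws(2) square_assoc[of _ 2])
  then show ?thesis
    using Ws Z unfolding cost_at_most_def by (intro exI[of _ "pauli_Z # Ws @ [pauli_Z]"]) auto
qed

lemma generate_pauli_Z_conjugate:
  assumes "pauli_Z \<in> G" "U \<in> generate (unitary_group 2) G"
  shows "pauli_Z * U * pauli_Z \<in> generate (unitary_group 2) G"
  using generate.eng[OF generate.eng[OF generate.incl[OF assms(1)] assms(2)] generate.incl[OF assms(1)]]
  by (simp add: unitary_group_def)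

lemma axial_rotation_mat2: "mat_exp ((\<i> * complex_of_real \<theta>) \<cdot>\<^sub>m pauli_Z) = mat2 (cis \<theta>) 0 0 (cnj (cis \<theta>))"
  by (simp add: mat_exp_pauli_Z cis_cnj) (simp add: cis_conv_exp)

section \<open>Mixing an over-rotated and an under-rotated gate\<close>

theorem theorem2:
  fixes G :: "complex mat set"
    and C :: "complex mat \<Rightarrow> real"
    and f_ax :: "real \<Rightarrow> real"
  assumes G_unitary: "G \<subseteq> carrier (unitary_group 2)"
    and C_nonneg: "\<And>W. W \<in> G \<Longrightarrow> 0 \<le> C W"
    and Z_in_G: "pauli_Z \<in> G"
    and Z_cost: "C pauli_Z = 0"
    and synthesis:
      "\<And>V \<epsilon>. V \<in> axial_rotations \<Longrightarrow> 0 < \<epsilon> \<Longrightarrow>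
         \<exists>U \<in> generate (unitary_group 2) G.
           cost_at_most 2 G C (f_ax \<epsilon>) U \<and> op_norm (U - V) \<le> \<epsilon>"
  shows "\<forall>V \<in> axial_rotations. \<forall>\<epsilon>::real. 0 < \<epsilon> \<and> \<epsilon> < 0.01 \<longrightarrow>
     (\<exists>(U :: nat \<Rightarrow> complex mat) (p :: nat \<Rightarrow> real).
        (\<forall>j\<in>{1..4}. U j \<in> generate (unitary_group 2) G \<and> cost_at_most 2 G C (f_ax \<epsilon>) (U j)) \<and>
        (\<forall>j\<in>{1..4}. 0 \<le> p j) \<and> (\<Sum>j\<in>{1..4}. p j) = 1 \<and>
        diamond_dist 2 (mixed_unitary_channel 2 {1..4} p U) (unitary_channel V) \<le> 5 * \<epsilon>^2)"
proof (intro ballI allI impI)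
  fix V and \<epsilon> :: real
  assume "V \<in> axial_rotations" and "0 < \<epsilon> \<and> \<epsilon> < 0.01"
  then obtain \<theta> where V: "V = mat2 (cis \<theta>) 0 0 (cnj (cis \<theta>))" and \<epsilon>: "0 < \<epsilon>" "\<epsilon> < 0.01"
    by (auto simp: axial_rotations_def axial_rotation_mat2)
  have gen_unitary: "unitary_mat 2 U" if "U \<in> generate (unitary_group 2) G" for U
    using group.generate_in_carrier[OF group_unitary_group G_unitary that] by (simp add: unitary_group_def)
  \<comment> \<open>\<open>a\<close> bounds the real parts of the aligned diagonal entries from
    below, and \<open>c\<close> is the cosine of twice arccos \<open>a\<close>, the largest relative
    phase error this bound allows.\<close>
  define a where "a = 1 - \<epsilon>\<^sup>2 / 2"
  define c where "c = 2 * a\<^sup>2 - 1"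
  have "\<epsilon> \<le> 1 / 2" using \<epsilon>(2) by (simp add: power2_eq_square)
  then have e2: "\<epsilon>\<^sup>2 \<le> 1 / 4" using power_mono[of \<epsilon> "1 / 2" 2] \<epsilon>(1) by (simp add: power2_eq_square)
  have c_eq: "c = 1 - 2 * \<epsilon>\<^sup>2 + (\<epsilon>\<^sup>2)\<^sup>2 / 2"
    by (simp add: c_def a_def power2_eq_square algebra_simps)
  have a0: "0 \<le> a" using e2 by (simp add: a_def)
  have "0 \<le> (\<epsilon>\<^sup>2)\<^sup>2" by simp
  then have c0: "0 \<le> c" using e2 unfolding c_eq by linarith
  have a1: "a \<le> 1" by (simp add: a_def)
  have c1: "c \<le> 1" using a0 a1 power_le_one[of a 2] by (simp add: c_def)
  \<comment> \<open>This is arccos \<open>a\<close>: the offset that just outweighs the worst phase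
    error of a synthesized gate.\<close>
  define \<delta> where "\<delta> = arccos c / 2"
  define s where "s = sin (2 * \<delta>)"
  have cos: "cos (2 * \<delta>) = c" using c0 c1 by (simp add: \<delta>_def)
  have s0: "0 \<le> s"
    using c0 c1 arccos_lbound[of c] arccos_ubound[of c] unfolding s_def \<delta>_def by (intro sin_ge_zero) auto
  have s2: "s\<^sup>2 = 1 - c\<^sup>2" using sin_squared_eq[of "2 * \<delta>"] by (simp add: s_def cos)
  have cis2\<delta>: "cis (2 * \<delta>) = Complex c s" by (simp add: cis.ctr cos s_def)
  have approx: "\<exists>u x y v. mat2 u x y v \<in> generate (unitary_group 2) G \<and> cost_at_most 2 G C (f_ax \<epsilon>) (mat2 u x y v) \<and>
      unitary_mat 2 (mat2 u x y v) \<and> a \<le> Re (u * cnj (cis \<phi>)) \<and> a \<le> Re (v * cis \<phi>)" for \<phi>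
  proof -
    have "mat2 (cis \<phi>) 0 0 (cnj (cis \<phi>)) \<in> axial_rotations"
      unfolding axial_rotations_def axial_rotation_mat2 by blast
    from synthesis[OF this \<epsilon>(1)] obtain U where U: "U \<in> generate (unitary_group 2) G"
      "cost_at_most 2 G C (f_ax \<epsilon>) U" "op_norm (U - mat2 (cis \<phi>) 0 0 (cnj (cis \<phi>))) \<le> \<epsilon>" by blast
    obtain u x y v where "U = mat2 u x y v" using unitary_matD(1)[OF gen_unitary[OF U(1)]] by (rule mat2_cases)
    with U gen_unitary[OF U(1)] unitary_mat2_near_diagonal[of u x y v "cis \<phi>" \<epsilon>] show ?thesis
      unfolding a_def by auto
  qed
  obtain u x y v where U: "mat2 u x y v \<in> generate (unitary_group 2) G" "cost_at_most 2 G C (f_ax \<epsilon>) (mat2 u x y v)"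
    and Uu: "unitary_mat 2 (mat2 u x y v)" and uv: "a \<le> Re (u * cnj (cis (\<theta> + \<delta>)))" "a \<le> Re (v * cis (\<theta> + \<delta>))"
    using approx[of "\<theta> + \<delta>"] by blast
  obtain u' x' y' v' where U': "mat2 u' x' y' v' \<in> generate (unitary_group 2) G" "cost_at_most 2 G C (f_ax \<epsilon>) (mat2 u' x' y' v')"
    and Uu': "unitary_mat 2 (mat2 u' x' y' v')" and uv': "a \<le> Re (u' * cnj (cis (\<theta> - \<delta>)))" "a \<le> Re (v' * cis (\<theta> - \<delta>))"
    using approx[of "\<theta> - \<delta>"] by blast
  note e = unitary_mat2_entries[OF Uu] and e' = unitary_mat2_entries[OF Uu']
  \<comment> \<open>Relative phases of the diagonal entries with that of \<open>V\<close> divided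
    out; for \<open>V\<close> itself the value would be 1.\<close>
  define g where "g = u * cnj v * cis (- 2 * \<theta>)"
  define g' where "g' = u' * cnj v' * cis (- 2 * \<theta>)"
  \<comment> \<open>The offset enters the two diagonal entries with opposite signs, hence the
    product as a rotation by \<open>2 * \<delta>\<close>.\<close>
  have g_eq: "g = (u * cnj (cis (\<theta> + \<delta>))) * cnj (v * cis (\<theta> + \<delta>)) * Complex c s"
  proof -
    have "cnj (cis (\<theta> + \<delta>)) * cnj (cis (\<theta> + \<delta>)) * cis (2 * \<delta>) = cis (- 2 * \<theta>)"
      by (simp add: cis_cnj cis_mult)
    then show ?thesis unfolding g_def cis2\<delta>[symmetric] by (simp add: mult_ac)
  qed
  have g'_eq: "cnj g' = cnj (u' * cnj (cis (\<theta> - \<delta>))) * cnj (cnj (v' * cis (\<theta> - \<delta>))) * Complex c s"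
  proof -
    have "cis (\<theta> - \<delta>) * cis (\<theta> - \<delta>) * cis (2 * \<delta>) = cis (2 * \<theta>)"
      by (simp add: cis_mult)
    then show ?thesis unfolding g'_def cis2\<delta>[symmetric] by (simp add: mult_ac cis_cnj)
  qed
  have "(cmod (u * cnj (cis (\<theta> + \<delta>))))\<^sup>2 = 1 - (cmod x)\<^sup>2" "(cmod (v * cis (\<theta> + \<delta>)))\<^sup>2 = 1 - (cmod x)\<^sup>2"
    "1 - (cmod x)\<^sup>2 \<le> 1"
    by (simp_all add: norm_mult e)
  note g = rotated_product_bounds[OF this a0 uv c_def c0 s0 s2, folded g_eq]
  \<comment> \<open>Conjugation turns under-rotation into over-rotation, so the same estimate
    applies to \<open>cnj g'\<close>.\<close>
  have "(cmod (cnj (u' * cnj (cis (\<theta> - \<delta>)))))\<^sup>2 = 1 - (cmod x')\<^sup>2" "(cmod (cnj (v' * cis (\<theta> - \<delta>))))\<^sup>2 = 1 - (cmod x')\<^sup>2"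
    "1 - (cmod x')\<^sup>2 \<le> 1"
    by (simp_all add: norm_mult e')
  moreover have "a \<le> Re (cnj (u' * cnj (cis (\<theta> - \<delta>))))" "a \<le> Re (cnj (v' * cis (\<theta> - \<delta>)))"
    using uv' by simp_all
  ultimately have "0 \<le> Im (cnj g')" "1 - 2 * s\<^sup>2 + (1 - (1 - (cmod x')\<^sup>2)) \<le> Re (cnj g')"
    unfolding g'_eq using a0 c_def c0 s0 s2 by (blast intro: rotated_product_bounds)+
  then have g': "Im g' \<le> 0" "1 - 2 * s\<^sup>2 + (1 - (1 - (cmod x')\<^sup>2)) \<le> Re g'" by simp_all
  have cg: "Re g \<le> 1 - (cmod x)\<^sup>2" "Re g' \<le> 1 - (cmod x')\<^sup>2"
  proof -
    have "cmod u = cmod v" "cmod u' = cmod v'"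
      using e e' by (metis norm_ge_zero power2_eq_imp_eq)+
    then have "cmod g = 1 - (cmod x)\<^sup>2" "cmod g' = 1 - (cmod x')\<^sup>2"
      unfolding e(2)[symmetric] e'(2)[symmetric] by (simp_all add: g_def g'_def norm_mult power2_eq_square)
    then show "Re g \<le> 1 - (cmod x)\<^sup>2" "Re g' \<le> 1 - (cmod x')\<^sup>2"
      using complex_Re_le_cmod[of g] complex_Re_le_cmod[of g'] by auto
  qed
  \<comment> \<open>This weight cancels the imaginary parts, so the mixture has no net phase
    error.\<close>
  obtain p where p: "0 \<le> p" "p \<le> 1" and pI: "p * Im g + (1 - p) * Im g' = 0"
    by (rule convex_combination_zero[OF g(1) g'(1)])
  define z where "z = p * Re g + (1 - p) * Re g'"
  define \<eta> where "\<eta> = p * (cmod x)\<^sup>2 + (1 - p) * (cmod x')\<^sup>2"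
  have "p * Re g \<le> p * (1 - (cmod x)\<^sup>2)" "(1 - p) * Re g' \<le> (1 - p) * (1 - (cmod x')\<^sup>2)"
    using cg p by (auto intro!: mult_left_mono)
  then have z1: "z \<le> 1 - \<eta>" by (simp add: z_def \<eta>_def algebra_simps)
  have "p * (1 - 2 * s\<^sup>2 + (1 - (1 - (cmod x)\<^sup>2))) \<le> p * Re g"
    "(1 - p) * (1 - 2 * s\<^sup>2 + (1 - (1 - (cmod x')\<^sup>2))) \<le> (1 - p) * Re g'"
    using g g' p by (auto intro!: mult_left_mono)
  \<comment> \<open>The surplus terms in the bounds on \<open>Re g\<close> and \<open>Re g'\<close>
    average to \<eta> and absorb the antidiagonal contribution.\<close>
  then have z2: "1 - z + \<eta> \<le> 2 * s\<^sup>2" by (simp add: z_def \<eta>_def algebra_simps)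
  have gz: "of_real p * g + of_real (1 - p) * g' = of_real z"
    using pI by (simp add: complex_eq_iff z_def)
  have cis1: "cis (- 2 * \<theta>) * (cis \<theta>)\<^sup>2 = 1"
    by (simp add: cis_mult power2_eq_square)
  have zV: "of_real p * (u * cnj v) + of_real (1 - p) * (u' * cnj v') = of_real z * (cis \<theta>)\<^sup>2"
  proof -
    have "of_real z * (cis \<theta>)\<^sup>2 =
        (of_real p * (u * cnj v) + of_real (1 - p) * (u' * cnj v')) * (cis (- 2 * \<theta>) * (cis \<theta>)\<^sup>2)"
      unfolding gz[symmetric] g_def g'_def by (simp only: distrib_right mult.assoc)
    then show ?thesis unfolding cis1 by simp
  qed
  let ?U = "twirled_pair (mat2 u x y v) (mat2 u' x' y' v')"
  have "diamond_norm 2 (\<lambda>\<rho>. mixed_unitary_channel 2 {1..4} (twirled_weights p) ?U \<rho> - unitary_channel V \<rho>)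
      \<le> 1 - z + \<eta>"
    unfolding V by (rule diamond_norm_twirled_mixture_le[OF Uu Uu' _ p \<eta>_def zV z1]) simp
  also have "\<dots> \<le> 2 * s\<^sup>2" by (rule z2)
  \<comment> \<open>Here \<open>1 - c\<close> is at most \<open>2 * \<epsilon>\<^sup>2\<close> and
    \<open>1 + c\<close> at most 2, so \<open>2 * s\<^sup>2\<close> is at most
    \<open>8 * \<epsilon>\<^sup>2\<close>. The factor one half in the distance turns the bound 10
    into 5.\<close>
  also have "\<dots> \<le> 10 * \<epsilon>\<^sup>2"
  proof -
    have "s\<^sup>2 = (1 - c) * (1 + c)" unfolding s2 by (simp add: power2_eq_square algebra_simps)
    also have "\<dots> \<le> (2 * \<epsilon>\<^sup>2) * 2" using c0 c1 by (intro mult_mono) (auto simp: c_eq)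
    finally show ?thesis using zero_le_power2[of \<epsilon>] by linarith
  qed
  finally have dist: "diamond_dist 2 (mixed_unitary_channel 2 {1..4} (twirled_weights p) ?U) (unitary_channel V) \<le> 5 * \<epsilon>\<^sup>2"
    by (simp add: diamond_dist_def)
  have gates: "?U j \<in> generate (unitary_group 2) G" "cost_at_most 2 G C (f_ax \<epsilon>) (?U j)" for j
    using U U' generate_pauli_Z_conjugate[OF Z_in_G] cost_at_most_pauli_Z_conjugate[where C = C, OF G_unitary Z_in_G Z_cost]
    by (auto simp: twirled_pair_def)
  have weights: "0 \<le> twirled_weights p j" for j using p by (simp add: twirled_weights_def)
  have total: "(\<Sum>j\<in>{1..4}. twirled_weights p j) = 1"
    unfolding sum_1_to_4 by (simp add: twirled_weights_def field_simps)
  show "\<exists>(U :: nat \<Rightarrow> complex mat) (p :: nat \<Rightarrow> real).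
        (\<forall>j\<in>{1..4}. U j \<in> generate (unitary_group 2) G \<and> cost_at_most 2 G C (f_ax \<epsilon>) (U j)) \<and>
        (\<forall>j\<in>{1..4}. 0 \<le> p j) \<and> (\<Sum>j\<in>{1..4}. p j) = 1 \<and>
        diamond_dist 2 (mixed_unitary_channel 2 {1..4} p U) (unitary_channel V) \<le> 5 * \<epsilon>^2"
    by (intro exI[of _ ?U] exI[of _ "twirled_weights p"] conjI ballI) (rule gates weights total dist)+
qed

end
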